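(* Consider the SDP problem (P) and its dual (D) given in the context. Suppose that for any $w\in\mathrm{dom}(h)$ there exist $\kappa_1>0$ and a neighborhood $\mathcal{W}\subseteq\mathbb{W}$ of $w$ such that $h(w')\ge h(w)+\langle\nabla h(w),w'-w\rangle+\kappa_1\|w'-w\|^2$ for all $w'\in\mathcal{W}$. Then $\mathcal{T}_\phi$ is metrically subregular at any $X\in\mathcal{T}_\phi^{-1}(0)$ for the origin under one of the following two conditions: (i) there exist $\overline{X}\in\mathcal{T}_\phi^{-1}(0)$ and $(\bar y,\bar w,\overline{S})\in\mathcal{M}_\phi(\overline{X})$ such that $\mathrm{rank}(\overline{S})\ge n-1$; (ii) there exist $\overline{X}\in\mathcal{T}_\phi^{-1}(0)$ and $(\bar y,\bar w,\overline{S})\in\mathcal{M}_\phi(\overline{X})$ such that $\mathrm{rank}(\overline{X})+\mathrm{rank}(\overline{S})=n$.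
   Context: $\mathbb{S}^n$: real symmetric $n\times n$ matrices with trace inner product and Frobenius norm; $\mathbb{S}^n_+$: positive semidefinite cone. $\mathbb{Y},\mathbb{W}$ are finite dimensional real Euclidean spaces; $\mathcal{F}:\mathbb{S}^n\to\mathbb{W}$, $\mathcal{A}:\mathbb{S}^n\to\mathbb{Y}$ are linear with adjoints $\mathcal{F}^*,\mathcal{A}^*$; $\mathcal{Q}\subseteq\mathbb{Y}$ is a convex polyhedral cone with polar $\mathcal{Q}^\circ$; $C\in\mathbb{S}^n$, $b\in\mathbb{Y}$. $h:\mathbb{W}\to(-\infty,+\infty]$ is continuously differentiable on $\mathrm{dom}(h)$, which is a non-empty open convex set, and strictly convex on any convex subset of $\mathrm{dom}(h)$; $h^*$ is its conjugate; $\delta_D$ is the indicator function of $D$ and $\mathcal{N}_D$ its normal cone. (P): $\min\{h(\mathcal{F}X)+\langle C,X\rangle+\delta_{\mathbb{S}^n_+}(X): b-\mathcal{A}X\in\mathcal{Q}^\circ\}$. (D): $\min\{\delta_{\mathcal{Q}}(y)-\langle b,y\rangle+h^*(-w)+\delta_{\mathbb{S}^n_+}(S):\mathcal{A}^*y+\mathcal{F}^*w+S=C\}$. The Lagrangian of (D) is $l(z,X)=\delta_{\mathcal{Q}}(y)-\langle b,y\rangle+h^*(-w)+\delta_{\mathbb{S}^n_+}(S)+\langle X,\mathcal{A}^*y+\mathcal{F}^*w+S-C\rangle$ for $z=(y,w,S)$; $\phi(X)=\inf_z l(z,X)$ (concave), and $\mathcal{T}_\phi=-\partial\phi$ (the convex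 subdifferential of $-\phi$). $\mathcal{T}_\phi^{-1}(0)$ is the optimal solution set of (P). $\mathcal{M}_\phi(\overline{X})$ is the set of Lagrange multipliers $(y,w,S)\in\mathbb{Y}\times\mathbb{W}\times\mathbb{S}^n$ corresponding to $\overline{X}$, i.e. those satisfying the KKT system $0\in-b+\mathcal{A}\overline{X}+\mathcal{N}_{\mathcal{Q}}(y)$, $0\in\mathcal{F}\overline{X}-\partial h^*(-w)$, $0\in\overline{X}+\mathcal{N}_{\mathbb{S}^n_+}(S)$, $\mathcal{A}^*y+\mathcal{F}^*w+S=C$. A multi-valued mapping $F$ is metrically subregular at $\bar x$ for $\bar y$ if $\bar y\in F(\bar x)$ and there are $\kappa\ge0$ and a neighborhood $\mathcal{U}$ of $\bar x$ with $\mathrm{dist}(x,F^{-1}(\bar y))\le\kappa\,\mathrm{dist}(\bar y,F(x))$ for all $x\in\mathcal{U}$.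
   Formalization: The point X̄ in (i) and (ii) is also required to be an optimal solution of (P); the stated identity of T_φ^{-1}(0) with the solution set of (P) can fail when h is not lower semicontinuous, and then the claim is false (n=1, h(x)=(1-x)^4 on (-1,1)). *)

theory Defs
  imports "HOL-Analysis.Analysis"
begin

section \<open>The Euclidean space of real symmetric matrices\<close>

typedef 'n symmat = "{A :: real^'n^'n. transpose A = A}"
  morphisms mat_of symmat_of
proof
  show "0 \<in> {A :: real^'n^'n. transpose A = A}"
    by (simp add: transpose_def vec_eq_iff)
qed

lemma transpose_mat_of [simp]: "transpose (mat_of A) = mat_of A"
  using mat_of[of A] by simp

lemma mat_of_sym: "mat_of A $ i $ j = mat_of A $ j $ i"
proof -
  have "transpose (mat_of A) $ i $ j = mat_of A $ i $ j" by simp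
  then show ?thesis by (simp add: transpose_def)
qed

instantiation symmat :: (finite) real_vector
begin

definition zero_symmat :: "'a symmat" where "0 = symmat_of 0"
definition plus_symmat :: "'a symmat \<Rightarrow> 'a symmat \<Rightarrow> 'a symmat"
  where "A + B = symmat_of (mat_of A + mat_of B)"
definition minus_symmat :: "'a symmat \<Rightarrow> 'a symmat \<Rightarrow> 'a symmat"
  where "A - B = symmat_of (mat_of A - mat_of B)"
definition uminus_symmat :: "'a symmat \<Rightarrow> 'a symmat"
  where "- A = symmat_of (- mat_of A)"
definition scaleR_symmat :: "real \<Rightarrow> 'a symmat \<Rightarrow> 'a symmat"
  where "c *\<^sub>R A = symmat_of (c *\<^sub>R mat_of A)"

lemma mat_of_simps:
  fixes A B :: "'a symmat"
  shows "mat_of (0 :: 'a symmat) = 0"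
    and "mat_of (A + B) = mat_of A + mat_of B"
    and "mat_of (A - B) = mat_of A - mat_of B"
    and "mat_of (- A) = - mat_of A"
    and "mat_of (c *\<^sub>R A) = c *\<^sub>R mat_of A"
  by (simp_all add: zero_symmat_def plus_symmat_def minus_symmat_def uminus_symmat_def
      scaleR_symmat_def symmat_of_inverse transpose_def vec_eq_iff mat_of_sym)

instance
proof
  fix A B D :: "'a symmat" and r s :: real
  show "A + B + D = A + (B + D)" "A + B = B + A" "0 + A = A" "- A + A = 0" "A - B = A + - B"
    by (simp_all add: mat_of_inject [symmetric] mat_of_simps)
  show "r *\<^sub>R (A + B) = r *\<^sub>R A + r *\<^sub>R B" "(r + s) *\<^sub>R A = r *\<^sub>R A + s *\<^sub>R A"
    "r *\<^sub>R s *\<^sub>R A = (r * s) *\<^sub>R A" "1 *\<^sub>R A = A"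
    by (simp_all add: mat_of_inject [symmetric] mat_of_simps scaleR_add_right scaleR_add_left)
qed

end

text \<open>On \<^typ>\<open>real^'n^'n\<close> the library norm is the Frobenius norm.\<close>

instantiation symmat :: (finite) real_normed_vector
begin

definition norm_symmat :: "'a symmat \<Rightarrow> real"
  where "norm_symmat A = norm (mat_of A)"
definition sgn_symmat :: "'a symmat \<Rightarrow> 'a symmat"
  where "sgn_symmat A = A /\<^sub>R norm A"
definition dist_symmat :: "'a symmat \<Rightarrow> 'a symmat \<Rightarrow> real"
  where "dist_symmat A B = norm (A - B)"
definition uniformity_symmat :: "('a symmat \<times> 'a symmat) filter"
  where "uniformity_symmat = (INF e\<in>{0<..}. principal {(A, B). dist A B < e})"
definition open_symmat :: "'a symmat set \<Rightarrow> bool"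
  where "open_symmat U \<longleftrightarrow> (\<forall>x\<in>U. eventually (\<lambda>(x', y). x' = x \<longrightarrow> y \<in> U) uniformity)"

instance
proof
  fix A B :: "'a symmat" and r :: real
  show "dist A B = norm (A - B)" by (rule dist_symmat_def)
  show "sgn A = A /\<^sub>R norm A" by (rule sgn_symmat_def)
  show "uniformity = (INF e\<in>{0<..}. principal {(x, y :: 'a symmat). dist x y < e})"
    by (rule uniformity_symmat_def)
  show "open U \<longleftrightarrow> (\<forall>x\<in>U. eventually (\<lambda>(x', y). x' = x \<longrightarrow> y \<in> U) uniformity)"
    for U :: "'a symmat set"
    by (rule open_symmat_def)
  show "norm A = 0 \<longleftrightarrow> A = 0"
    by (metis mat_of_inject mat_of_simps(1) norm_eq_zero norm_symmat_def)
  show "norm (A + B) \<le> norm A + norm B" "norm (r *\<^sub>R A) = \<bar>r\<bar> * norm A"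
    by (simp_all add: norm_symmat_def mat_of_simps norm_triangle_ineq)
qed

end

instantiation symmat :: (finite) real_inner
begin

definition inner_symmat :: "'a symmat \<Rightarrow> 'a symmat \<Rightarrow> real"
  where "A \<bullet> B = trace (mat_of A ** mat_of B)"

lemma inner_symmat_eq: "A \<bullet> B = mat_of A \<bullet> mat_of B" for A B :: "'a symmat"
  unfolding inner_symmat_def trace_def matrix_matrix_mult_def inner_vec_def
  by (simp add: mat_of_sym[of B])

instance
proof
  fix A B D :: "'a symmat" and r :: real
  show "A \<bullet> B = B \<bullet> A" "(A + B) \<bullet> D = A \<bullet> D + B \<bullet> D" "(r *\<^sub>R A) \<bullet> B = r * (A \<bullet> B)"
    "0 \<le> A \<bullet> A"
    by (simp_all add: inner_symmat_eq mat_of_simps inner_commute inner_add_left inner_add_right)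
  show "A \<bullet> A = 0 \<longleftrightarrow> A = 0"
    by (metis inner_symmat_eq inner_eq_zero_iff mat_of_inject mat_of_simps(1))
  show "norm A = sqrt (A \<bullet> A)"
    by (simp add: norm_symmat_def inner_symmat_eq norm_eq_sqrt_inner)
qed

end

lemma symmat_orthonormal_basis:
  "\<exists>B :: 'n::finite symmat set. B \<noteq> {} \<and> finite B \<and>
      (\<forall>u\<in>B. \<forall>v\<in>B. u \<bullet> v = (if u = v then 1 else 0)) \<and>
      (\<forall>x. (\<forall>u\<in>B. x \<bullet> u = 0) \<longleftrightarrow> x = 0)"
proof -
  let ?S = "{A :: real^'n^'n. transpose A = A}"
  have "subspace ?S"
    by (auto simp: subspace_def transpose_def vec_eq_iff)
  then obtain B where B: "B \<subseteq> ?S" "pairwise orthogonal B" "\<And>x. x \<in> B \<Longrightarrow> norm x = 1"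
      "independent B" "card B = dim ?S" "span B = ?S"
    by (rule orthonormal_basis_subspace) (rule that)
  have "finite B" using B(4) by (rule independent_imp_finite)
  then have fin: "finite (symmat_of ` B)" by simp
  let ?B = "symmat_of ` B"
  have inv: "mat_of (symmat_of u) = u" if "u \<in> B" for u
    using that B(1) by (intro symmat_of_inverse) auto
  have one: "mat 1 \<in> ?S" by simp
  have one0: "(mat 1 :: real^'n^'n) \<noteq> 0"
    by (auto simp: mat_def vec_eq_iff)
  have "B \<noteq> {}"
  proof
    assume "B = {}"
    with B(6) have "?S = {0}" by simp
    with one one0 show False by blast
  qed
  then have ne: "?B \<noteq> {}" by simp
  have ortho: "u \<bullet> v = (if u = v then 1 else 0)" if uv: "u \<in> ?B" "v \<in> ?B" for u v
  proof -
    obtain a b where ab: "a \<in> B" "b \<in> B" "u = symmat_of a" "v = symmat_of b"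
      using uv by blast
    have "u = v \<longleftrightarrow> a = b" using ab inv by metis
    moreover have "u \<bullet> v = a \<bullet> b" using ab inv by (simp add: inner_symmat_eq)
    moreover have "a \<bullet> a = 1" using B(3)[OF ab(1)] by (simp add: norm_eq_1)
    moreover have "a \<noteq> b \<Longrightarrow> a \<bullet> b = 0"
      using B(2) ab by (auto simp: pairwise_def orthogonal_def)
    ultimately show ?thesis by auto
  qed
  have zero: "(\<forall>u\<in>?B. x \<bullet> u = 0) \<longleftrightarrow> x = 0" for x
  proof
    assume x: "\<forall>u\<in>?B. x \<bullet> u = 0"
    have "orthogonal (mat_of x) b" if "b \<in> B" for b
      using x that inv[OF that] by (auto simp: orthogonal_def inner_symmat_eq)
    moreover have "mat_of x \<in> span B" using mat_of[of x] B(6) by simp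
    ultimately have "orthogonal (mat_of x) (mat_of x)"
      by (rule orthogonal_to_span[rotated])
    then have "x \<bullet> x = 0" by (simp add: orthogonal_def inner_symmat_eq)
    then show "x = 0" by simp
  qed simp
  show "\<exists>B :: 'n symmat set. B \<noteq> {} \<and> finite B \<and>
      (\<forall>u\<in>B. \<forall>v\<in>B. u \<bullet> v = (if u = v then 1 else 0)) \<and>
      (\<forall>x. (\<forall>u\<in>B. x \<bullet> u = 0) \<longleftrightarrow> x = 0)"
    by (intro exI[of _ ?B] conjI ballI allI ne fin ortho zero)
qed

instantiation symmat :: (finite) euclidean_space
begin

text \<open>Only the existence of an orthonormal basis matters; the choice is irrelevant.\<close>

definition Basis_symmat :: "'a symmat set" where
  "Basis_symmat = (SOME B. B \<noteq> {} \<and> finite B \<and>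
      (\<forall>u\<in>B. \<forall>v\<in>B. u \<bullet> v = (if u = v then 1 else 0)) \<and>
      (\<forall>x. (\<forall>u\<in>B. x \<bullet> u = 0) \<longleftrightarrow> x = 0))"

instance
proof
  note * = someI_ex[OF symmat_orthonormal_basis[where 'n = 'a], folded Basis_symmat_def]
  show "(Basis :: 'a symmat set) \<noteq> {}" "finite (Basis :: 'a symmat set)"
    using * by blast+
  show "u \<bullet> v = (if u = v then 1 else 0)" if "u \<in> Basis" "v \<in> Basis" for u v :: "'a symmat"
    using * that by blast
  show "(\<forall>u\<in>Basis. x \<bullet> u = 0) \<longleftrightarrow> x = 0" for x :: "'a symmat"
    using * by blast
qed

end

definition psd_cone :: "'n::finite symmat set" where
  "psd_cone = {A. \<forall>v. 0 \<le> v \<bullet> (mat_of A *v v)}"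

section \<open>Convex analysis\<close>

definition edom :: "('a \<Rightarrow> ereal) \<Rightarrow> 'a set" where
  "edom f = {x. f x < \<infinity>}"

definition strictly_convex_on :: "'a::real_vector set \<Rightarrow> ('a \<Rightarrow> ereal) \<Rightarrow> bool" where
  "strictly_convex_on D f \<longleftrightarrow>
     (\<forall>x\<in>D. \<forall>y\<in>D. \<forall>t. x \<noteq> y \<longrightarrow> 0 < t \<longrightarrow> t < 1 \<longrightarrow>
        f ((1 - t) *\<^sub>R x + t *\<^sub>R y) < ereal (1 - t) * f x + ereal t * f y)"

definition indicator_fn :: "'a set \<Rightarrow> 'a \<Rightarrow> ereal" where
  "indicator_fn D x = (if x \<in> D then 0 else \<infinity>)"

definition polar_cone :: "'a::real_inner set \<Rightarrow> 'a set" where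
  "polar_cone K = {v. \<forall>x\<in>K. v \<bullet> x \<le> 0}"

definition normal_cone :: "'a::real_inner set \<Rightarrow> 'a \<Rightarrow> 'a set" where
  "normal_cone D x = (if x \<in> D then {v. \<forall>y\<in>D. v \<bullet> (y - x) \<le> 0} else {})"

definition conjugate :: "('a::real_inner \<Rightarrow> ereal) \<Rightarrow> 'a \<Rightarrow> ereal" where
  "conjugate f v = (SUP x. ereal (v \<bullet> x) - f x)"

text \<open>By convention the subdifferential is empty where the function is not finite.\<close>

definition subdifferential :: "('a::real_inner \<Rightarrow> ereal) \<Rightarrow> 'a \<Rightarrow> 'a set" where
  "subdifferential f x =
     (if \<bar>f x\<bar> = \<infinity> then {} else {v. \<forall>y. f x + ereal (v \<bullet> (y - x)) \<le> f y})"

text \<open>The distance to the empty set is \<open>\<infinity>\<close>; the library's \<open>infdist\<close> would give \<open>0\<close>.\<close>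

definition set_distance :: "'a::metric_space \<Rightarrow> 'a set \<Rightarrow> ereal" where
  "set_distance x D = (INF y\<in>D. ereal (dist x y))"

text \<open>Since \<open>0 * \<infinity> = 0\<close> in \<^typ>\<open>ereal\<close>, the modulus \<open>\<kappa> = 0\<close> is read strictly at points where
  \<open>F x = {}\<close>. This does not affect the notion, because \<open>\<kappa>\<close> can always be enlarged.\<close>

definition metrically_subregular ::
    "('a::metric_space \<Rightarrow> 'b::metric_space set) \<Rightarrow> 'a \<Rightarrow> 'b \<Rightarrow> bool" where
  "metrically_subregular F x0 y0 \<longleftrightarrow>
     y0 \<in> F x0 \<and>
     (\<exists>\<kappa>\<ge>0. \<exists>U. open U \<and> x0 \<in> U \<and>
        (\<forall>x\<in>U. set_distance x {x'. y0 \<in> F x'} \<le> ereal \<kappa> * set_distance y0 (F x)))"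

section \<open>The primal and dual problems\<close>

definition primal_objective ::
    "('w \<Rightarrow> ereal) \<Rightarrow> ('n::finite symmat \<Rightarrow> 'w) \<Rightarrow> 'n symmat \<Rightarrow> 'n symmat \<Rightarrow> ereal" where
  "primal_objective h F C X = h (F X) + ereal (C \<bullet> X) + indicator_fn psd_cone X"

definition primal_feasible ::
    "('n::finite symmat \<Rightarrow> 'y::euclidean_space) \<Rightarrow> 'y \<Rightarrow> 'y set \<Rightarrow> 'n symmat set" where
  "primal_feasible A b Q = {X. b - A X \<in> polar_cone Q}"

definition primal_solutions ::
    "('w \<Rightarrow> ereal) \<Rightarrow> ('n::finite symmat \<Rightarrow> 'w) \<Rightarrow> ('n symmat \<Rightarrow> 'y::euclidean_space)
     \<Rightarrow> 'n symmat \<Rightarrow> 'y \<Rightarrow> 'y set \<Rightarrow> 'n symmat set" where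
  "primal_solutions h F A C b Q =
     {X \<in> primal_feasible A b Q. primal_objective h F C X < \<infinity> \<and>
        (\<forall>X'\<in>primal_feasible A b Q. primal_objective h F C X \<le> primal_objective h F C X')}"

definition dual_objective ::
    "('w::euclidean_space \<Rightarrow> ereal) \<Rightarrow> 'y::euclidean_space \<Rightarrow> 'y set
     \<Rightarrow> 'y \<times> 'w \<times> 'n::finite symmat \<Rightarrow> ereal" where
  "dual_objective h b Q = (\<lambda>(y, w, S).
     indicator_fn Q y - ereal (b \<bullet> y) + conjugate h (- w) + indicator_fn psd_cone S)"

definition dual_residual ::
    "('n::finite symmat \<Rightarrow> 'w::euclidean_space) \<Rightarrow> ('n symmat \<Rightarrow> 'y::euclidean_space)
     \<Rightarrow> 'n symmat \<Rightarrow> 'y \<times> 'w \<times> 'n symmat \<Rightarrow> 'n symmat" where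
  "dual_residual F A C = (\<lambda>(y, w, S). adjoint A y + adjoint F w + S - C)"

definition lagrangian ::
    "('w::euclidean_space \<Rightarrow> ereal) \<Rightarrow> ('n::finite symmat \<Rightarrow> 'w)
     \<Rightarrow> ('n symmat \<Rightarrow> 'y::euclidean_space) \<Rightarrow> 'n symmat \<Rightarrow> 'y \<Rightarrow> 'y set
     \<Rightarrow> 'y \<times> 'w \<times> 'n symmat \<Rightarrow> 'n symmat \<Rightarrow> ereal" where
  "lagrangian h F A C b Q z X = dual_objective h b Q z + ereal (X \<bullet> dual_residual F A C z)"

definition phi ::
    "('w::euclidean_space \<Rightarrow> ereal) \<Rightarrow> ('n::finite symmat \<Rightarrow> 'w)
     \<Rightarrow> ('n symmat \<Rightarrow> 'y::euclidean_space) \<Rightarrow> 'n symmat \<Rightarrow> 'y \<Rightarrow> 'y set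
     \<Rightarrow> 'n symmat \<Rightarrow> ereal" where
  "phi h F A C b Q X = (INF z. lagrangian h F A C b Q z X)"

definition T_phi ::
    "('w::euclidean_space \<Rightarrow> ereal) \<Rightarrow> ('n::finite symmat \<Rightarrow> 'w)
     \<Rightarrow> ('n symmat \<Rightarrow> 'y::euclidean_space) \<Rightarrow> 'n symmat \<Rightarrow> 'y \<Rightarrow> 'y set
     \<Rightarrow> 'n symmat \<Rightarrow> 'n symmat set" where
  "T_phi h F A C b Q = subdifferential (\<lambda>X. - phi h F A C b Q X)"

text \<open>
  Pitfall: \<open>phi\<close> only sees the closure of \<open>h\<close>. For lower semicontinuous \<open>h\<close> the zeros of \<open>T_phi\<close>
  are exactly the elements of \<open>primal_solutions\<close>. Otherwise \<open>T_phi\<close> may have zeros \<open>X\<close> with \<open>F X\<close>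
  on the boundary of the open set \<open>edom h\<close>, where the primal objective is infinite: take \<open>n = 1\<close>,
  \<open>F\<close> the identification of 1-by-1 matrices with reals, \<open>A = 0\<close>, \<open>b = 0\<close>, \<open>C = 0\<close>,
  \<open>h x = (1 - x)^4\<close> on \<open>(-1, 1)\<close>, and the zero \<open>X = 1\<close>.
\<close>

definition multipliers ::
    "('w::euclidean_space \<Rightarrow> ereal) \<Rightarrow> ('n::finite symmat \<Rightarrow> 'w)
     \<Rightarrow> ('n symmat \<Rightarrow> 'y::euclidean_space) \<Rightarrow> 'n symmat \<Rightarrow> 'y \<Rightarrow> 'y set
     \<Rightarrow> 'n symmat \<Rightarrow> ('y \<times> 'w \<times> 'n symmat) set" where
  "multipliers h F A C b Q X = {(y, w, S).
     0 \<in> (\<lambda>v. - b + A X + v) ` normal_cone Q y \<and>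
     0 \<in> (\<lambda>u. F X - u) ` subdifferential (conjugate h) (- w) \<and>
     0 \<in> (\<lambda>V. X + V) ` normal_cone psd_cone S \<and>
     adjoint A y + adjoint F w + S = C}"

end

theory Submission
  imports Defs
begin

text \<open>
  Put \<open>\<Phi> = -\<phi>\<close>. Off the constraints \<open>\<Phi>\<close> is infinite, and on them it equals
  \<open>h (F X) + \<langle>C, X\<rangle>\<close> wherever \<open>F X \<in> dom h\<close>. With the given multiplier \<open>(y, w, S)\<close>, where \<open>-w = \<nabla>h (w0)\<close>
  and \<open>w0 = F Xb\<close>, stationarity \<open>C = A\<^sup>* y + F\<^sup>* w + S\<close> and the local growth of \<open>h\<close> give
  \<open>\<Phi> X - min \<Phi> \<ge> \<kappa> \<parallel>F X - w0\<parallel>\<^sup>2 + \<langle>y, A X - b\<rangle> + \<langle>S, X\<rangle>\<close> for \<open>F X\<close> near \<open>w0\<close>, all three terms being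
  nonnegative. Hence the minimisers are exactly the feasible \<open>X\<close> with \<open>F X = w0\<close>, \<open>\<langle>y, A X - b\<rangle> = 0\<close>
  and \<open>X S = 0\<close>. The distance to this set is bounded by Hoffman's lemma for the linear equations
  together with \<open>\<parallel>X S\<parallel>\<^sup>2 \<le> K \<parallel>X\<parallel> \<langle>S, X\<rangle>\<close>; the rank conditions allow the remaining semidefinite
  constraint to be restored at the cost of a constant factor. The resulting quadratic growth of the
  convex function \<open>\<Phi>\<close> yields subregularity through the subgradient inequality.
\<close>

section \<open>Hoffman's error bound\<close>

text \<open>The nonnegative combinations already form a convex cone containing \<open>G\<close>, so
  minimality of the hull suffices.\<close>

lemma convex_cone_hull_finite_sum:
  fixes G :: "'a::euclidean_space set"
  assumes "finite G" and "x \<in> convex_cone hull G"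
  shows "\<exists>u. (\<forall>g\<in>G. 0 \<le> u g) \<and> x = (\<Sum>g\<in>G. u g *\<^sub>R g)"
proof -
  let ?K = "{x. \<exists>u. (\<forall>g\<in>G. 0 \<le> u g) \<and> x = (\<Sum>g\<in>G. u g *\<^sub>R g)}"
  have "convex_cone hull G \<subseteq> ?K"
  proof (rule hull_minimal)
    show "G \<subseteq> ?K"
    proof
      fix g assume "g \<in> G"
      then have "g = (\<Sum>k\<in>G. (if k = g then 1 else 0) *\<^sub>R k)"
        using assms(1) by (simp add: if_distrib[of "\<lambda>a. a *\<^sub>R _"] cong: if_cong)
      then show "g \<in> ?K"
        by (auto intro!: exI[of _ "\<lambda>k. if k = g then 1 else 0"])
    qed
    show "convex_cone ?K"
      unfolding convex_cone_iff
    proof (intro conjI ballI allI impI)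
      show "0 \<in> ?K" by (auto intro!: exI[of _ "\<lambda>_. 0"])
    next
      fix x y assume "x \<in> ?K" "y \<in> ?K"
      then obtain u v where "\<forall>g\<in>G. 0 \<le> u g" "x = (\<Sum>g\<in>G. u g *\<^sub>R g)"
        "\<forall>g\<in>G. 0 \<le> v g" "y = (\<Sum>g\<in>G. v g *\<^sub>R g)" by auto
      then show "x + y \<in> ?K"
        by (auto intro!: exI[of _ "\<lambda>g. u g + v g"] simp: scaleR_add_left sum.distrib)
    next
      fix x and c :: real assume "x \<in> ?K" "0 \<le> c"
      then obtain u where "\<forall>g\<in>G. 0 \<le> u g" "x = (\<Sum>g\<in>G. u g *\<^sub>R g)" by auto
      with \<open>0 \<le> c\<close> show "c *\<^sub>R x \<in> ?K"
        by (auto intro!: exI[of _ "\<lambda>g. c * u g"] simp: scaleR_sum_right)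
    qed
  qed
  then show ?thesis using assms(2) by auto
qed

text \<open>Caratheodory's argument: move the weights along a linear dependence until the first of
  them reaches zero.\<close>

lemma conic_combination_drop:
  fixes G :: "'a::euclidean_space set"
  assumes "finite G" "dependent G" "\<forall>g\<in>G. 0 \<le> u g" "x = (\<Sum>g\<in>G. u g *\<^sub>R g)"
  shows "\<exists>k\<in>G. x \<in> convex_cone hull (G - {k})"
proof -
  obtain m0 where m0: "(\<Sum>g\<in>G. m0 g *\<^sub>R g) = 0" "\<exists>g\<in>G. m0 g \<noteq> 0"
    using assms(2) dependent_finite[OF assms(1)] by auto
  \<comment> \<open>A dependence may be negated, so one with a positive coefficient exists; the
    ratio test below needs it.\<close>
  have "\<exists>m. (\<Sum>g\<in>G. m g *\<^sub>R g) = 0 \<and> (\<exists>g\<in>G. m g > 0)"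
  proof (cases "\<exists>g\<in>G. m0 g > 0")
    case True with m0 show ?thesis by blast
  next
    case False
    with m0 have "(\<Sum>g\<in>G. (- m0 g) *\<^sub>R g) = 0 \<and> (\<exists>g\<in>G. - m0 g > 0)"
      by (auto simp: sum_negf) (meson linorder_neqE_linordered_idom)
    then show ?thesis by (intro exI[of _ "\<lambda>g. - m0 g"])
  qed
  then obtain m where m: "(\<Sum>g\<in>G. m g *\<^sub>R g) = 0" "\<exists>g\<in>G. m g > 0" by blast
  let ?P = "{g\<in>G. m g > 0}"
  \<comment> \<open>Ratio test: the smallest ratio is the largest step that keeps all weights
    nonnegative, and it annihilates the weight of \<open>k\<close>.\<close>
  obtain k where k: "k \<in> ?P" "\<And>g. g \<in> ?P \<Longrightarrow> u k / m k \<le> u g / m g"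
    using ex_is_arg_min_if_finite[of ?P "\<lambda>g. u g / m g"] assms(1) m(2)
    by (auto simp: is_arg_min_linorder)
  define t where "t = u k / m k"
  have t: "t \<ge> 0" using k assms(3) by (auto simp: t_def)
  define v where "v g = u g - t * m g" for g
  have v: "0 \<le> v g" if "g \<in> G" for g
  proof (cases "m g > 0")
    case True
    then have "t \<le> u g / m g" using k(2)[of g] that by (simp add: t_def)
    then show ?thesis using True by (simp add: v_def field_simps)
  next
    case False
    then have "t * m g \<le> 0" using t by (simp add: mult_nonneg_nonpos)
    then show ?thesis using assms(3) that by (smt (verit) v_def)
  qed
  have vk: "v k = 0" using k(1) by (simp add: v_def t_def)
  have "x = (\<Sum>g\<in>G. v g *\<^sub>R g)"
    using m(1) by (simp add: v_def assms(4) scaleR_diff_left sum_subtractf flip: scaleR_scaleR scaleR_sum_right)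
  also have "\<dots> = (\<Sum>g\<in>G-{k}. v g *\<^sub>R g)"
    using k(1) assms(1) vk by (subst sum.remove[of _ k]) auto
  finally have x: "x = (\<Sum>g\<in>G-{k}. v g *\<^sub>R g)" .
  have "(\<Sum>g\<in>G'. v g *\<^sub>R g) \<in> convex_cone hull (G-{k})" if "G' \<subseteq> G - {k}" for G'
    using finite_subset[OF that finite_Diff[OF assms(1)]] that
  proof (induction G' rule: finite_induct)
    case (insert g G')
    then have "v g *\<^sub>R g \<in> convex_cone hull (G-{k})"
      using v by (intro convex_cone_hull_mul hull_inc) auto
    with insert show ?case by (simp add: convex_cone_hull_add)
  qed (simp_all add: convex_cone_hull_contains_0)
  with x show ?thesis using k(1) by (intro bexI[of _ k]) auto
qed

lemma conic_combination_bound: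
  fixes G :: "'a::euclidean_space set"
  assumes "finite G"
  shows "\<exists>c\<ge>0. \<forall>x\<in>convex_cone hull G. \<exists>u. (\<forall>g\<in>G. 0 \<le> u g) \<and>
           x = (\<Sum>g\<in>G. u g *\<^sub>R g) \<and> sum u G \<le> c * norm x"
  using assms
proof (induction G rule: finite_psubset_induct)
  case (psubset G)
  show ?case
  proof (cases "independent G")
    case True
    have "\<exists>B\<ge>0. \<forall>u. u g \<le> B * norm (\<Sum>k\<in>G. u k *\<^sub>R k)" if g: "g \<in> G" for g
    proof -
      \<comment> \<open>The coordinate functional of \<open>g\<close>, extended to the whole
        space.\<close>
      obtain f where f: "linear f" "\<forall>k\<in>G. f k = (if k = g then 1 else 0 :: real)"
        using linear_independent_extend[OF True, of "\<lambda>k. if k = g then 1 else 0 :: real"] by blast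
      obtain B where B: "B > 0" "\<And>x. norm (f x) \<le> B * norm x"
        using linear_bounded_pos[OF f(1)] by blast
      have "u g \<le> B * norm (\<Sum>k\<in>G. u k *\<^sub>R k)" for u
      proof -
        have "f (\<Sum>k\<in>G. u k *\<^sub>R k) = (\<Sum>k\<in>G. u k * f k)"
          using f(1) by (simp add: linear_sum linear_cmul)
        also have "\<dots> = (\<Sum>k\<in>G. u k * (if k = g then 1 else 0))"
          using f(2) by (intro sum.cong) auto
        also have "\<dots> = u g"
          using g psubset.hyps by (simp add: if_distrib[of "\<lambda>a. _ * a"] cong: if_cong)
        finally show ?thesis using B(2)[of "\<Sum>k\<in>G. u k *\<^sub>R k"] by simp
      qed
      with B(1) show ?thesis by (intro exI[of _ B]) auto
    qed
    then obtain B where B: "\<And>g. g \<in> G \<Longrightarrow> B g \<ge> 0"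
      "\<And>g u. g \<in> G \<Longrightarrow> u g \<le> B g * norm (\<Sum>k\<in>G. u k *\<^sub>R k)" by metis
    show ?thesis
    proof (intro exI[of _ "sum B G"] conjI ballI)
      show "0 \<le> sum B G" by (simp add: B sum_nonneg)
      fix x assume "x \<in> convex_cone hull G"
      then obtain u where u: "\<forall>g\<in>G. 0 \<le> u g" "x = (\<Sum>g\<in>G. u g *\<^sub>R g)"
        using convex_cone_hull_finite_sum[OF psubset.hyps] by blast
      have "sum u G \<le> sum B G * norm x"
        unfolding sum_distrib_right u(2) by (intro sum_mono B)
      with u show "\<exists>u. (\<forall>g\<in>G. 0 \<le> u g) \<and> x = (\<Sum>g\<in>G. u g *\<^sub>R g) \<and> sum u G \<le> sum B G * norm x"
        by blast
    qed
  next
    case False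
    have "\<forall>k\<in>G. \<exists>c\<ge>0. \<forall>x\<in>convex_cone hull (G - {k}). \<exists>u. (\<forall>g\<in>G - {k}. 0 \<le> u g) \<and>
           x = (\<Sum>g\<in>G - {k}. u g *\<^sub>R g) \<and> sum u (G - {k}) \<le> c * norm x"
    proof
      fix k assume "k \<in> G"
      then have "G - {k} \<subset> G" by blast
      then show "\<exists>c\<ge>0. \<forall>x\<in>convex_cone hull (G - {k}). \<exists>u. (\<forall>g\<in>G - {k}. 0 \<le> u g) \<and>
           x = (\<Sum>g\<in>G - {k}. u g *\<^sub>R g) \<and> sum u (G - {k}) \<le> c * norm x"
        by (rule psubset.IH)
    qed
    from bchoice[OF this] obtain c where c: "\<And>k. k \<in> G \<Longrightarrow> c k \<ge> 0"
      "\<And>k x. k \<in> G \<Longrightarrow> x \<in> convex_cone hull (G - {k}) \<Longrightarrow> \<exists>u. (\<forall>g\<in>G - {k}. 0 \<le> u g) \<and>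
           x = (\<Sum>g\<in>G - {k}. u g *\<^sub>R g) \<and> sum u (G - {k}) \<le> c k * norm x"
      by blast
    \<comment> \<open>Which generator is dropped depends on \<open>x\<close>; summing all the
      constants makes the bound uniform.\<close>
    show ?thesis
    proof (intro exI[of _ "sum c G"] conjI ballI)
      show "0 \<le> sum c G" by (simp add: c sum_nonneg)
      fix x assume x: "x \<in> convex_cone hull G"
      then obtain k where k: "k \<in> G" "x \<in> convex_cone hull (G - {k})"
        using convex_cone_hull_finite_sum[OF psubset.hyps x]
          conic_combination_drop[OF psubset.hyps] False by blast
      then obtain u where u: "\<forall>g\<in>G - {k}. 0 \<le> u g" "x = (\<Sum>g\<in>G - {k}. u g *\<^sub>R g)"
        "sum u (G - {k}) \<le> c k * norm x" using c(2) by blast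
      let ?v = "u(k := 0)"
      have "(\<Sum>g\<in>G. ?v g *\<^sub>R g) = (\<Sum>g\<in>G - {k}. ?v g *\<^sub>R g)" "sum ?v G = sum ?v (G - {k})"
        using k(1) psubset.hyps by (auto simp: sum.remove[of _ k])
      moreover have "(\<Sum>g\<in>G - {k}. ?v g *\<^sub>R g) = x" "sum ?v (G - {k}) = sum u (G - {k})"
        unfolding u(2) by (auto intro!: sum.cong)
      moreover have "c k \<le> sum c G"
        using c(1) k(1) psubset.hyps by (intro member_le_sum) auto
      then have "c k * norm x \<le> sum c G * norm x" by (rule mult_right_mono) simp
      ultimately show "\<exists>u. (\<forall>g\<in>G. 0 \<le> u g) \<and> x = (\<Sum>g\<in>G. u g *\<^sub>R g) \<and> sum u G \<le> sum c G * norm x"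
        using u(1,3) by (intro exI[of _ ?v]) auto
    qed
  qed
qed

section \<open>Distance to a polyhedron\<close>

text \<open>Project \<open>d\<close> onto the cone of active normals. The residual \<open>s\<close>
  is a feasible direction at \<open>z\<close>, so \<open>d \<bullet> s \<le> 0\<close>; but
  \<open>d \<bullet> s = s \<bullet> s\<close>, and therefore \<open>s = 0\<close>.\<close>

lemma normal_vector_polyhedron:
  fixes z d :: "'a::euclidean_space"
  assumes I: "finite I" and z: "\<forall>(g, \<beta>)\<in>I. g \<bullet> z \<le> \<beta>"
    and d: "\<And>y. \<forall>(g, \<beta>)\<in>I. g \<bullet> y \<le> \<beta> \<Longrightarrow> d \<bullet> (y - z) \<le> 0"
  shows "d \<in> convex_cone hull {g. \<exists>\<beta>. (g, \<beta>) \<in> I \<and> g \<bullet> z = \<beta>}" (is "d \<in> convex_cone hull ?G")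
proof -
  let ?K = "convex_cone hull ?G"
  have "?G \<subseteq> fst ` I" by force
  then have "finite ?G" using I finite_surj by blast
  then have cl: "closed ?K" by (rule closed_convex_cone_hull)
  have cv: "convex ?K" by (rule convex_convex_cone_hull)
  have ne: "0 \<in> ?K" by (rule convex_cone_hull_contains_0)
  define p where "p = closest_point ?K d"
  define s where "s = d - p"
  have p: "p \<in> ?K" unfolding p_def using cl ne closest_point_in_set by blast
  have dot: "s \<bullet> (x - p) \<le> 0" if "x \<in> ?K" for x
    unfolding s_def p_def using closest_point_dot[OF cv cl that] .
  have sg: "s \<bullet> g \<le> 0" if "g \<in> ?G" for g
    using dot[of "p + g"] p that by (simp add: convex_cone_hull_add hull_inc)
  \<comment> \<open>The points 0 and \<open>2 *\<^sub>R p\<close> of the cone give the two opposite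
    inequalities.\<close>
  have sp: "s \<bullet> p = 0"
    using dot[of 0] ne dot[of "2 *\<^sub>R p"] p by (simp add: convex_cone_hull_mul inner_diff_right)
  have "\<forall>(g, \<beta>)\<in>I. \<exists>e>0. \<forall>t. 0 < t \<and> t \<le> e \<longrightarrow> g \<bullet> (z + t *\<^sub>R s) \<le> \<beta>"
  proof (clarify)
    fix g \<beta> assume gI: "(g, \<beta>) \<in> I"
    show "\<exists>e>0. \<forall>t. 0 < t \<and> t \<le> e \<longrightarrow> g \<bullet> (z + t *\<^sub>R s) \<le> \<beta>"
    proof (cases "g \<bullet> z = \<beta>")
      case True
      then have "g \<bullet> s \<le> 0" using sg[of g] gI by (auto simp: inner_commute)
      then show ?thesis using True
        by (intro exI[of _ 1]) (auto simp: inner_add_right mult_le_0_iff)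
    next
      case False
      then have lt: "g \<bullet> z < \<beta>" using z gI by force
      \<comment> \<open>A step no longer than this uses up at most the slack; the added 1 avoids
        division by zero.\<close>
      let ?e = "(\<beta> - g \<bullet> z) / (1 + \<bar>g \<bullet> s\<bar>)"
      have "g \<bullet> (z + t *\<^sub>R s) \<le> \<beta>" if t: "0 < t" "t \<le> ?e" for t
      proof -
        have "t * (1 + \<bar>g \<bullet> s\<bar>) \<le> \<beta> - g \<bullet> z" using t by (simp add: field_simps)
        moreover have "t * (g \<bullet> s) \<le> t * (1 + \<bar>g \<bullet> s\<bar>)" using t by (intro mult_left_mono) auto
        ultimately show ?thesis by (simp add: inner_add_right)
      qed
      then show ?thesis using lt by (intro exI[of _ ?e]) (auto simp: add_pos_nonneg)
    qed
  qed
  then obtain e where e: "\<And>i. i \<in> I \<Longrightarrow> e i > 0"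
    "\<And>i t. i \<in> I \<Longrightarrow> 0 < t \<Longrightarrow> t \<le> e i \<Longrightarrow> fst i \<bullet> (z + t *\<^sub>R s) \<le> snd i"
    by (simp add: case_prod_beta) metis
  \<comment> \<open>The element 1 keeps the minimum defined when \<open>I\<close> is empty.\<close>
  define t where "t = Min (insert 1 (e ` I))"
  have t: "0 < t" "\<And>i. i \<in> I \<Longrightarrow> t \<le> e i"
    using I e(1) by (auto simp: t_def)
  have "d \<bullet> ((z + t *\<^sub>R s) - z) \<le> 0"
    using e(2) t by (intro d) (auto simp: case_prod_beta)
  then have "d \<bullet> s \<le> 0" using t(1) by (simp add: mult_le_0_iff)
  moreover have "d \<bullet> s = s \<bullet> s"
    using sp by (simp add: s_def inner_diff_left inner_diff_right inner_commute)
  ultimately have "s = 0" by (metis inner_gt_zero_iff not_le)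
  then show ?thesis using p by (simp add: s_def)
qed

text \<open>With \<open>z\<close> the projection of \<open>x\<close>, the vector
  \<open>d = x - z\<close> is a combination of active normals whose weights sum to at most a
  constant times \<open>norm d\<close>. Each active normal \<open>g\<close> satisfies
  \<open>g \<bullet> d \<le> r\<close>, so pairing with \<open>d\<close> bounds
  \<open>norm d\<close> squared by that constant times \<open>norm d * r\<close>.\<close>

theorem Hoffman_error_bound:
  fixes I :: "('a::euclidean_space \<times> real) set"
  assumes I: "finite I" and z0: "\<forall>(g, \<beta>)\<in>I. g \<bullet> z0 \<le> \<beta>"
  shows "\<exists>c\<ge>0. \<forall>x r. (\<forall>(g, \<beta>)\<in>I. g \<bullet> x \<le> \<beta> + r) \<longrightarrow> 0 \<le> r \<longrightarrow>
           (\<exists>z. (\<forall>(g, \<beta>)\<in>I. g \<bullet> z \<le> \<beta>) \<and> norm (x - z) \<le> c * r)"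
proof -
  let ?P = "{z. \<forall>(g, \<beta>)\<in>I. g \<bullet> z \<le> \<beta>}"
  have P: "?P = (\<Inter>(g, \<beta>)\<in>I. {z. g \<bullet> z \<le> \<beta>})" by auto
  have cl: "closed ?P" unfolding P by (auto intro!: closed_INT simp: closed_halfspace_le)
  have cv: "convex ?P" unfolding P by (auto intro!: convex_INT simp: convex_halfspace_le)
  have fin: "finite (fst ` I)" using I by simp
  have "\<forall>G\<in>Pow (fst ` I). \<exists>c\<ge>0. \<forall>x\<in>convex_cone hull G. \<exists>u. (\<forall>g\<in>G. 0 \<le> u g) \<and>
           x = (\<Sum>g\<in>G. u g *\<^sub>R g) \<and> sum u G \<le> c * norm x"
    using fin by (auto intro!: conic_combination_bound finite_subset[OF _ fin])
  from bchoice[OF this] obtain c where c: "\<forall>G\<in>Pow (fst ` I). c G \<ge> 0 \<and> (\<forall>x\<in>convex_cone hull G.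
      \<exists>u. (\<forall>g\<in>G. 0 \<le> u g) \<and> x = (\<Sum>g\<in>G. u g *\<^sub>R g) \<and> sum u G \<le> c G * norm x)" ..
  \<comment> \<open>The active set varies with \<open>x\<close>, so the constants of all possible
    sets of normals are added up.\<close>
  let ?c = "sum c (Pow (fst ` I))"
  have "\<exists>z. (\<forall>(g, \<beta>)\<in>I. g \<bullet> z \<le> \<beta>) \<and> norm (x - z) \<le> ?c * r"
    if x: "\<forall>(g, \<beta>)\<in>I. g \<bullet> x \<le> \<beta> + r" and r: "0 \<le> r" for x r
  proof -
    define z where "z = closest_point ?P x"
    have z: "z \<in> ?P" unfolding z_def using cl z0 closest_point_in_set by blast
    define d where "d = x - z"
    let ?G = "{g. \<exists>\<beta>. (g, \<beta>) \<in> I \<and> g \<bullet> z = \<beta>}"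
    have sub: "?G \<subseteq> fst ` I" by force
    have "d \<in> convex_cone hull ?G"
    proof (rule normal_vector_polyhedron[OF I])
      show "\<forall>(g, \<beta>)\<in>I. g \<bullet> z \<le> \<beta>" using z by blast
      show "d \<bullet> (y - z) \<le> 0" if "\<forall>(g, \<beta>)\<in>I. g \<bullet> y \<le> \<beta>" for y
        unfolding d_def z_def using closest_point_dot[OF cv cl] that by blast
    qed
    then obtain u where u: "\<forall>g\<in>?G. 0 \<le> u g" "d = (\<Sum>g\<in>?G. u g *\<^sub>R g)" "sum u ?G \<le> c ?G * norm d"
      using c sub by blast
    have "(norm d)\<^sup>2 = (\<Sum>g\<in>?G. u g * (g \<bullet> d))"
      unfolding power2_norm_eq_inner by (subst u(2)) (simp add: inner_sum_left)
    also have "\<dots> \<le> (\<Sum>g\<in>?G. u g * r)"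
    proof (rule sum_mono)
      fix g assume g: "g \<in> ?G"
      then have "g \<bullet> d \<le> r" using x by (auto simp: d_def inner_diff_right)
      then show "u g * (g \<bullet> d) \<le> u g * r" using u(1) g by (intro mult_left_mono) auto
    qed
    also have "\<dots> \<le> (c ?G * norm d) * r"
      unfolding sum_distrib_right[symmetric] using u(3) r by (rule mult_right_mono)
    finally have "norm d * norm d \<le> norm d * (c ?G * r)" by (simp add: power2_eq_square algebra_simps)
    then have "norm d \<le> c ?G * r"
      using r c sub by (cases "norm d = 0") (auto simp: mult_le_cancel_left)
    also have "c ?G \<le> ?c" using sub c fin by (intro member_le_sum) auto
    then have "c ?G * r \<le> ?c * r" using r by (rule mult_right_mono)
    finally show ?thesis using z by (auto simp: d_def intro!: exI[of _ z])
  qed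
  moreover have "?c \<ge> 0" using c by (intro sum_nonneg) auto
  ultimately show ?thesis by blast
qed

text \<open>The equation \<open>T z = T x0\<close> is written as two inequalities per basis
  coordinate. The inequalities of \<open>P\<close> hold at \<open>x\<close>, so the residual of
  \<open>T\<close> alone serves as the violation \<open>r\<close>.\<close>

corollary polyhedron_linear_error_bound:
  fixes T :: "'a::euclidean_space \<Rightarrow> 'b::euclidean_space"
  assumes P: "polyhedron P" and T: "linear T" and x0: "x0 \<in> P"
  shows "\<exists>c\<ge>0. \<forall>x\<in>P. \<exists>z\<in>P. T z = T x0 \<and> norm (x - z) \<le> c * norm (T x - T x0)"
proof -
  obtain H where H: "finite H" "P = \<Inter>H" "\<forall>h\<in>H. \<exists>a b. a \<noteq> 0 \<and> h = {x. a \<bullet> x \<le> b}"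
    using P unfolding polyhedron_def by blast
  then obtain a b where ab: "\<And>h. h \<in> H \<Longrightarrow> h = {x. a h \<bullet> x \<le> b h}" by metis
  define I where "I = (\<lambda>h. (a h, b h)) ` H
    \<union> (\<lambda>i. (adjoint T i, T x0 \<bullet> i)) ` Basis \<union> (\<lambda>i. (- adjoint T i, - (T x0 \<bullet> i))) ` Basis"
  have adj: "adjoint T i \<bullet> x = T x \<bullet> i" for i x
    using adjoint_works[OF T, of x i] by (simp add: inner_commute)
  have I: "(\<forall>(g, \<beta>)\<in>I. g \<bullet> x \<le> \<beta> + r) \<longleftrightarrow>
      (\<forall>h\<in>H. a h \<bullet> x \<le> b h + r) \<and> (\<forall>i\<in>Basis. \<bar>(T x - T x0) \<bullet> i\<bar> \<le> r)" for x r
    unfolding I_def ball_Un by (auto simp: adj abs_le_iff inner_diff_left algebra_simps)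
  have I0: "(\<forall>(g, \<beta>)\<in>I. g \<bullet> x \<le> \<beta>) \<longleftrightarrow> x \<in> P \<and> T x = T x0" for x
  proof -
    have "x \<in> P \<longleftrightarrow> (\<forall>h\<in>H. a h \<bullet> x \<le> b h)" using H(2) ab by blast
    then show ?thesis using I[of x 0] by (auto simp: euclidean_eq_iff[of "T x"] inner_diff_left)
  qed
  have fin: "finite I" using H(1) by (simp add: I_def)
  obtain c where c: "c \<ge> 0" "\<And>x r. (\<forall>(g, \<beta>)\<in>I. g \<bullet> x \<le> \<beta> + r) \<Longrightarrow> 0 \<le> r \<Longrightarrow>
      (\<exists>z. (\<forall>(g, \<beta>)\<in>I. g \<bullet> z \<le> \<beta>) \<and> norm (x - z) \<le> c * r)"
    using Hoffman_error_bound[OF fin, of x0] I0[of x0] x0 by blast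
  have "\<exists>z\<in>P. T z = T x0 \<and> norm (x - z) \<le> c * norm (T x - T x0)" if x: "x \<in> P" for x
  proof -
    have "a h \<bullet> x \<le> b h + norm (T x - T x0)" if "h \<in> H" for h
    proof -
      have "a h \<bullet> x \<le> b h" using x H(2) ab that by blast
      then show ?thesis by (simp add: add_increasing2)
    qed
    then have "\<forall>(g, \<beta>)\<in>I. g \<bullet> x \<le> \<beta> + norm (T x - T x0)"
      unfolding I by (simp add: Basis_le_norm)
    from c(2)[OF this] show ?thesis unfolding I0 by auto
  qed
  with c(1) show ?thesis by blast
qed

text \<open>Cutting the cone with a cube leaves a polytope, and every element of the cone can be
  scaled into the cube.\<close>

lemma polyhedral_cone_finitely_generated:
  fixes Q :: "'a::euclidean_space set"
  assumes "convex_cone Q" and "polyhedron Q"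
  shows "\<exists>V. finite V \<and> V \<subseteq> Q \<and> convex_cone hull V = Q"
proof -
  let ?B = "cbox (- One) One :: 'a set"
  have "polytope (Q \<inter> ?B)"
    using assms(2) unfolding polytope_eq_bounded_polyhedron by (simp add: bounded_Int)
  then obtain V where V: "finite V" "Q \<inter> ?B = convex hull V" unfolding polytope_def by blast
  have VQ: "V \<subseteq> Q" using V(2) hull_subset[of V convex] by blast
  have sub: "convex hull V \<subseteq> convex_cone hull V"
    by (simp add: convex_convex_cone_hull hull_minimal hull_subset)
  have "x \<in> convex_cone hull V" if x: "x \<in> Q" for x
  proof -
    define t where "t = inverse (1 + norm x)"
    have t: "0 < t" by (simp add: t_def add_pos_nonneg)
    have n: "t * norm x \<le> 1"
    proof -
      have "0 < 1 + norm x" by (simp add: add_pos_nonneg)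
      then show ?thesis by (simp add: t_def divide_simps)
    qed
    have "\<bar>(t *\<^sub>R x) \<bullet> i\<bar> \<le> 1" if "i \<in> Basis" for i
      using Basis_le_norm[OF that, of "t *\<^sub>R x"] n t by simp
    then have "t *\<^sub>R x \<in> ?B" by (auto simp: mem_box abs_le_iff minus_le_iff)
    moreover have "t *\<^sub>R x \<in> Q" using assms(1) t x by (simp add: convex_cone_scaleR)
    ultimately have "t *\<^sub>R x \<in> convex_cone hull V" using V(2) sub by blast
    then show ?thesis using t convex_cone_hull_mul[of "t *\<^sub>R x" V "inverse t"] by simp
  qed
  moreover have "convex_cone hull V \<subseteq> Q" by (rule hull_minimal[where s = V and t = Q and S = convex_cone, OF VQ assms(1)])
  ultimately show ?thesis using V(1) VQ by blast
qed

section \<open>Positive semidefinite matrices\<close>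

lemma psd_coneD: "X \<in> psd_cone \<Longrightarrow> 0 \<le> v \<bullet> (mat_of X *v v)"
  by (simp add: psd_cone_def)

lemma symmat_eqI: "mat_of X = mat_of Y \<Longrightarrow> X = Y"
  by (simp add: mat_of_inject)

lemma mat_of_dot: "u \<bullet> (mat_of X *v v) = (mat_of X *v u) \<bullet> v"
  by (metis dot_lmul_matrix transpose_mat_of vector_transpose_matrix)

lemma mat_of_add_vector: "mat_of (X + Y) *v v = mat_of X *v v + mat_of Y *v v"
  by (simp add: mat_of_simps matrix_vector_mult_add_rdistrib)

lemma mat_of_diff_vector: "mat_of (X - Y) *v v = mat_of X *v v - mat_of Y *v v"
  by (simp add: mat_of_simps matrix_vector_mult_diff_rdistrib)

lemma mat_of_scaleR_vector: "mat_of (c *\<^sub>R X) *v v = c *\<^sub>R (mat_of X *v v)"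
  by (simp add: mat_of_simps scaleR_matrix_vector_assoc)

lemma linear_mat_of_mult: "linear (\<lambda>X. mat_of X ** M)"
proof (rule linearI)
  show "mat_of (X + Y) ** M = mat_of X ** M + mat_of Y ** M" for X Y
    by (simp add: mat_of_simps vec_eq_iff matrix_matrix_mult_def distrib_right sum.distrib)
  show "mat_of (c *\<^sub>R X) ** M = c *\<^sub>R (mat_of X ** M)" for c X
    by (simp add: mat_of_simps vec_eq_iff matrix_matrix_mult_def sum_distrib_left mult.assoc)
qed

text \<open>The rank-one matrix u u^T. Pairing with it evaluates quadratic forms, and sums of such
  matrices exhaust the semidefinite cone.\<close>

definition outer :: "real^'n \<Rightarrow> 'n::finite symmat"
  where "outer u = symmat_of (\<chi> i j. u $ i * u $ j)"

lemma mat_of_outer: "mat_of (outer u) = (\<chi> i j. u $ i * u $ j)"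
  unfolding outer_def by (rule symmat_of_inverse) (simp add: transpose_def vec_eq_iff mult.commute)

lemma outer_vector: "mat_of (outer u) *v v = (u \<bullet> v) *\<^sub>R u"
  by (simp add: vec_eq_iff mat_of_outer matrix_vector_mult_def inner_vec_def sum_distrib_left
      sum_distrib_right mult_ac)

lemma inner_outer: "X \<bullet> outer u = u \<bullet> (mat_of X *v u)"
  unfolding inner_symmat_eq mat_of_outer
  by (simp add: inner_vec_def matrix_vector_mult_def sum_distrib_left mult_ac)

lemma norm_outer: "norm (outer u) = (norm u)\<^sup>2"
proof -
  have "outer u \<bullet> outer u = (u \<bullet> u)\<^sup>2"
    by (simp add: inner_outer outer_vector power2_eq_square)
  then show ?thesis by (simp add: norm_eq_sqrt_inner)
qed

lemma outer_psd: "outer u \<in> psd_cone"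
  by (simp add: psd_cone_def outer_vector inner_commute)

lemma quadratic_form_le: "u \<bullet> (mat_of X *v u) \<le> norm X * (norm u)\<^sup>2"
  using norm_cauchy_schwarz[of X "outer u"] by (simp add: inner_outer norm_outer)

lemma convex_cone_psd: "convex_cone psd_cone"
  unfolding convex_cone_iff psd_cone_def
  by (auto simp: mat_of_add_vector mat_of_scaleR_vector inner_add_right) (simp add: mat_of_simps)

text \<open>The form may be degenerate, so the case where it vanishes at \<open>v\<close> is treated
  apart.\<close>

lemma psd_cauchy_schwarz:
  assumes "X \<in> psd_cone"
  shows "(u \<bullet> (mat_of X *v v))\<^sup>2 \<le> (u \<bullet> (mat_of X *v u)) * (v \<bullet> (mat_of X *v v))"
proof -
  let ?q = "\<lambda>w. w \<bullet> (mat_of X *v w)"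
  define c where "c = u \<bullet> (mat_of X *v v)"
  have q: "0 \<le> ?q w" for w using assms by (rule psd_coneD)
  have exp: "?q (s *\<^sub>R u + t *\<^sub>R v) = s\<^sup>2 * ?q u + 2 * s * t * c + t\<^sup>2 * ?q v" for s t
  proof -
    have "v \<bullet> (mat_of X *v u) = c" by (metis c_def mat_of_dot inner_commute)
    then show ?thesis
      by (simp add: c_def matrix_vector_right_distrib matrix_vector_mult_scaleR inner_add_left
          inner_add_right power2_eq_square algebra_simps)
  qed
  show ?thesis
  proof (cases "?q v = 0")
    case True
    have "c = 0"
    proof (rule ccontr)
      assume "c \<noteq> 0"
      have "0 \<le> ?q u + 2 * t * c" for t using q[of "1 *\<^sub>R u + t *\<^sub>R v"] exp[of 1 t] True by simp
      \<comment> \<open>At this value of \<open>t\<close> the affine expression equals -1.\<close>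
      from this[of "- (?q u + 1) / (2 * c)"] \<open>c \<noteq> 0\<close> show False by (simp add: divide_simps)
    qed
    then show ?thesis by (simp add: True c_def)
  next
    case False
    then have pos: "?q v > 0" using q[of v] by linarith
    \<comment> \<open>The combination that minimises the form along \<open>v\<close>, multiplied by
      \<open>?q v\<close> to avoid division.\<close>
    have "0 \<le> (?q v)\<^sup>2 * ?q u - 2 * ?q v * c * c + c\<^sup>2 * ?q v"
      using q[of "?q v *\<^sub>R u + (-c) *\<^sub>R v"] exp[of "?q v" "-c"] by simp
    also have "\<dots> = ?q v * (?q u * ?q v - c\<^sup>2)" by (simp add: power2_eq_square algebra_simps)
    finally show ?thesis using pos by (simp add: zero_le_mult_iff c_def)
  qed
qed

text \<open>Cauchy-Schwarz for the form, with \<open>X u\<close> itself as the first vector,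
  followed by cancellation. In particular a zero of the form lies in the kernel.\<close>

lemma psd_vector_bound:
  assumes "X \<in> psd_cone"
  shows "(norm (mat_of X *v u))\<^sup>2 \<le> norm X * (u \<bullet> (mat_of X *v u))"
proof -
  let ?w = "mat_of X *v u"
  have "((norm ?w)\<^sup>2)\<^sup>2 = (?w \<bullet> (mat_of X *v u))\<^sup>2" by (simp add: power2_norm_eq_inner)
  also have "\<dots> \<le> (?w \<bullet> (mat_of X *v ?w)) * (u \<bullet> ?w)" using assms by (rule psd_cauchy_schwarz)
  also have "\<dots> \<le> (norm X * (norm ?w)\<^sup>2) * (u \<bullet> ?w)"
    using assms by (intro mult_right_mono quadratic_form_le psd_coneD)
  finally have "(norm ?w)\<^sup>2 * (norm ?w)\<^sup>2 \<le> (norm ?w)\<^sup>2 * (norm X * (u \<bullet> ?w))"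
    by (simp only: power2_eq_square mult_ac)
  moreover have "0 < (norm ?w)\<^sup>2" if "?w \<noteq> 0" using that by simp
  ultimately show ?thesis
    using psd_coneD[OF assms, of u] mult_le_cancel_left_pos by (cases "?w = 0") (simp, blast)
qed

section \<open>Kernels and decomposition into rank-one matrices\<close>

lemma subspace_kernel: "subspace {v. M *v v = (0 :: real^'m)}"
  by (simp add: subspace_def matrix_vector_right_distrib matrix_vector_mult_scaleR)

text \<open>By symmetry the kernel is the orthogonal complement of the range.\<close>

lemma symmat_rank_nullity:
  fixes S :: "'n::finite symmat"
  shows "dim {v. mat_of S *v v = 0} + rank (mat_of S) = CARD('n)"
proof -
  let ?R = "range ((*v) (mat_of S))"
  have "subspace ?R"
    using linear_subspace_image[OF matrix_vector_mul_linear subspace_UNIV] .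
  moreover have "{y \<in> UNIV. \<forall>x\<in>?R. orthogonal x y} = {v. mat_of S *v v = 0}"
    by (auto simp: orthogonal_def simp flip: mat_of_dot) (metis inner_eq_zero_iff)
  ultimately show ?thesis
    using dim_subspace_orthogonal_to_vectors[of ?R UNIV] by (simp add: rank_dim_range)
qed

text \<open>Serves in place of a spectral decomposition: a rank-one matrix is split off such that
  the rest stays semidefinite and has a strictly larger kernel.\<close>

lemma psd_cone_induct [consumes 1, case_names zero outer]:
  fixes S :: "'n::finite symmat"
  assumes "S \<in> psd_cone" and "P 0"
    and step: "\<And>S a. S \<in> psd_cone \<Longrightarrow> P S \<Longrightarrow> P (S + outer a)"
  shows "P S"
  using assms(1)
proof (induction S rule: measure_induct_rule[of "\<lambda>S. CARD('n) - dim {v. mat_of S *v v = 0}"])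
  case (less S)
  show ?case
  proof (cases "\<forall>u. u \<bullet> (mat_of S *v u) = 0")
    case True
    then have "mat_of S *v u = 0" for u
      using psd_vector_bound[OF less.prems, of u] by simp
    then have "mat_of S = mat_of 0" by (simp add: mat_of_simps matrix_eq)
    then show ?thesis using assms(2) symmat_eqI by metis
  next
    case False
    then obtain u where "u \<bullet> (mat_of S *v u) \<noteq> 0" by blast
    then have u: "0 < u \<bullet> (mat_of S *v u)" using psd_coneD[OF less.prems, of u] by simp
    let ?q = "u \<bullet> (mat_of S *v u)"
    \<comment> \<open>This scaling gives \<open>S' u = 0\<close>, and Cauchy-Schwarz for the form of
      \<open>S\<close> is exactly what keeps \<open>S'\<close> semidefinite.\<close>
    define a where "a = (1 / sqrt ?q) *\<^sub>R (mat_of S *v u)"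
    define S' where "S' = S - outer a"
    have S'v: "mat_of S' *v v = mat_of S *v v - ((u \<bullet> (mat_of S *v v)) / ?q) *\<^sub>R (mat_of S *v u)" for v
      using u by (simp add: S'_def mat_of_diff_vector outer_vector a_def mat_of_dot)
    have psd: "S' \<in> psd_cone"
      unfolding psd_cone_def
    proof (intro CollectI allI)
      fix v
      have "(v \<bullet> (mat_of S *v u))\<^sup>2 \<le> (v \<bullet> (mat_of S *v v)) * ?q"
        using psd_cauchy_schwarz[OF less.prems] .
      moreover have "v \<bullet> (mat_of S *v u) = u \<bullet> (mat_of S *v v)"
        by (metis mat_of_dot inner_commute)
      ultimately show "0 \<le> v \<bullet> (mat_of S' *v v)"
        using u unfolding S'v by (simp add: inner_diff_right field_simps power2_eq_square)
    qed
    have sub: "{v. mat_of S *v v = 0} \<subseteq> {v. mat_of S' *v v = 0}" by (auto simp: S'v)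
    have "u \<in> {v. mat_of S' *v v = 0}" using u by (simp add: S'v)
    moreover have "u \<notin> {v. mat_of S *v v = 0}" using u by auto
    ultimately have "dim {v. mat_of S *v v = 0} \<noteq> dim {v. mat_of S' *v v = 0}"
      using subspace_dim_equal[OF subspace_kernel subspace_kernel sub] by auto
    then have "dim {v. mat_of S *v v = 0} < dim {v. mat_of S' *v v = 0}"
      using dim_subset[OF sub] by linarith
    moreover have "dim {v. mat_of S' *v v = 0} \<le> CARD('n)"
      by (metis symmat_rank_nullity le_add1)
    ultimately have "P S'" using psd by (intro less.IH) auto
    then have "P (S' + outer a)" using psd by (rule step[rotated])
    then show ?thesis by (simp add: S'_def)
  qed
qed

section \<open>Products and complementarity\<close>

lemma psd_inner_nonneg:
  assumes "S \<in> psd_cone" "X \<in> psd_cone"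
  shows "0 \<le> S \<bullet> X"
  using assms(1)
proof (induction S rule: psd_cone_induct)
  case (outer S a)
  then show ?case
    using psd_coneD[OF assms(2), of a] inner_outer[of X a] by (simp add: inner_add_left inner_commute[of _ X] inner_add_right)
qed simp

lemma norm_matrix_mult_outer: "norm (M ** mat_of (outer a)) = norm (M *v a) * norm a"
proof -
  have eq: "M ** mat_of (outer a) = (\<chi> i j. (M *v a) $ i * a $ j)"
    by (simp add: vec_eq_iff mat_of_outer matrix_matrix_mult_def matrix_vector_mult_def
        sum_distrib_right sum_distrib_left mult_ac)
  have "(M ** mat_of (outer a)) \<bullet> (M ** mat_of (outer a)) = ((M *v a) \<bullet> (M *v a)) * (a \<bullet> a)"
    unfolding eq by (simp add: inner_vec_def sum_product mult_ac) (rule sum.swap)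
  then show ?thesis by (simp add: norm_eq_sqrt_inner real_sqrt_mult)
qed

text \<open>For rank-one \<open>S\<close> this is \<open>psd_vector_bound\<close>. Adding a rank-one
  matrix costs a factor 2 from squaring a sum of norms, and the extra cross terms on the right are
  nonnegative.\<close>

lemma psd_product_bound:
  assumes "S \<in> psd_cone"
  shows "\<exists>K\<ge>0. \<forall>X\<in>psd_cone. (norm (mat_of X ** mat_of S))\<^sup>2 \<le> K * norm X * (S \<bullet> X)"
  using assms
proof (induction S rule: psd_cone_induct)
  case zero
  then show ?case by (auto simp: mat_of_simps intro!: exI[of _ 0])
next
  case (outer S a)
  then obtain K where K: "K \<ge> 0"
    "\<And>X. X \<in> psd_cone \<Longrightarrow> (norm (mat_of X ** mat_of S))\<^sup>2 \<le> K * norm X * (S \<bullet> X)" by blast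
  let ?K = "2 * K + 2 * (norm a)\<^sup>2"
  have "(norm (mat_of X ** mat_of (S + outer a)))\<^sup>2 \<le> ?K * norm X * ((S + outer a) \<bullet> X)"
    if X: "X \<in> psd_cone" for X
  proof -
    let ?p = "norm (mat_of X ** mat_of S)" and ?r = "norm (mat_of X ** mat_of (outer a))"
    have p: "?p\<^sup>2 \<le> K * norm X * (S \<bullet> X)" using K(2)[OF X] .
    have o: "outer a \<bullet> X = a \<bullet> (mat_of X *v a)" by (metis inner_commute inner_outer)
    have "?r\<^sup>2 = (norm (mat_of X *v a))\<^sup>2 * (norm a)\<^sup>2"
      by (simp add: norm_matrix_mult_outer power_mult_distrib)
    also have "\<dots> \<le> (norm X * (outer a \<bullet> X)) * (norm a)\<^sup>2"
      unfolding o using psd_vector_bound[OF X] by (rule mult_right_mono) simp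
    finally have r: "?r\<^sup>2 \<le> (norm a)\<^sup>2 * norm X * (outer a \<bullet> X)" by (simp add: mult_ac)
    have S: "0 \<le> norm X * (S \<bullet> X)" using psd_inner_nonneg[OF outer.hyps X] by simp
    have a: "0 \<le> norm X * (outer a \<bullet> X)" using psd_inner_nonneg[OF outer_psd X] by simp
    have "norm (mat_of X ** mat_of (S + outer a)) \<le> ?p + ?r"
      by (simp add: mat_of_simps matrix_add_ldistrib norm_triangle_ineq)
    then have "(norm (mat_of X ** mat_of (S + outer a)))\<^sup>2 \<le> (?p + ?r)\<^sup>2"
      by (rule power_mono) simp
    also have "\<dots> \<le> 2 * ?p\<^sup>2 + 2 * ?r\<^sup>2"
      using sum_squares_bound[of ?p ?r] by (simp add: power2_sum)
    also have "\<dots> \<le> 2 * (K * norm X * (S \<bullet> X)) + 2 * ((norm a)\<^sup>2 * norm X * (outer a \<bullet> X))"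
      using p r by simp
    also have "\<dots> \<le> ?K * norm X * ((S + outer a) \<bullet> X)"
    proof -
      have "?K * norm X * ((S + outer a) \<bullet> X) =
        2 * (K * norm X * (S \<bullet> X)) + 2 * ((norm a)\<^sup>2 * norm X * (outer a \<bullet> X))
        + 2 * (K * (norm X * (outer a \<bullet> X))) + 2 * ((norm a)\<^sup>2 * (norm X * (S \<bullet> X)))"
        by (simp add: inner_add_left algebra_simps)
      moreover have "0 \<le> K * (norm X * (outer a \<bullet> X))" using K(1) a by (rule mult_nonneg_nonneg)
      moreover have "0 \<le> (norm a)\<^sup>2 * (norm X * (S \<bullet> X))" using S by (rule mult_nonneg_nonneg[rotated]) simp
      ultimately show ?thesis by linarith
    qed
    finally show ?thesis .
  qed
  with K(1) show ?case by (intro exI[of _ ?K]) auto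
qed

text \<open>Turns complementarity into an equation linear in \<open>X\<close>, the form to which
  Hoffman's bound applies.\<close>

lemma psd_inner_eq_0_iff:
  assumes "S \<in> psd_cone" "X \<in> psd_cone"
  shows "S \<bullet> X = 0 \<longleftrightarrow> mat_of X ** mat_of S = 0"
proof
  assume "S \<bullet> X = 0"
  with psd_product_bound[OF assms(1)] assms(2) show "mat_of X ** mat_of S = 0" by fastforce
next
  assume "mat_of X ** mat_of S = 0"
  then have "X \<bullet> S = 0" by (simp add: inner_symmat_def trace_def)
  then show "S \<bullet> X = 0" by (simp add: inner_commute)
qed

lemma symmat_mult_eq_0_commute:
  assumes "mat_of X ** mat_of S = 0"
  shows "mat_of S ** mat_of X = 0"
  using assms by (metis matrix_transpose_mul transpose_mat_of mat_of_simps(1))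

section \<open>Consequences of the two rank conditions\<close>

lemma trace_eq_inner: "trace (mat_of X) = symmat_of (mat 1) \<bullet> X"
  by (simp add: inner_symmat_def symmat_of_inverse)

lemma trace_psd_nonneg:
  assumes "X \<in> psd_cone"
  shows "0 \<le> trace (mat_of X)"
proof -
  have "mat_of X $ i $ i = axis i 1 \<bullet> (mat_of X *v axis i 1)" for i
    by (simp add: matrix_vector_mult_basis inner_axis' column_def)
  then have "0 \<le> mat_of X $ i $ i" for i using psd_coneD[OF assms] by metis
  then show ?thesis by (simp add: trace_def sum_nonneg)
qed

text \<open>The range of \<open>Z\<close> lies in the kernel of \<open>S\<close>, of dimension at
  most one. So \<open>Z\<close> is a multiple of some p p^T, and its trace has the sign of the
  factor.\<close>

lemma psd_if_trace_nonneg_corank_le_1: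
  fixes Z S :: "'n::finite symmat"
  assumes ZS: "mat_of Z ** mat_of S = 0" and rk: "rank (mat_of S) \<ge> CARD('n) - 1"
    and tr: "0 \<le> trace (mat_of Z)"
  shows "Z \<in> psd_cone"
proof (cases "\<forall>v. mat_of Z *v v = 0")
  case True
  then show ?thesis by (simp add: psd_cone_def)
next
  case False
  let ?N = "{v. mat_of S *v v = 0}"
  obtain v0 where v0: "mat_of Z *v v0 \<noteq> 0" using False by blast
  define p where "p = mat_of Z *v v0"
  have p: "p \<noteq> 0" using v0 by (simp add: p_def)
  have N: "mat_of Z *v v \<in> ?N" for v
    using symmat_mult_eq_0_commute[OF ZS] by (simp add: matrix_vector_mul_assoc)
  have dN: "dim ?N \<le> 1" using symmat_rank_nullity[of S] rk by linarith
  have "mat_of Z *v v \<in> span {p}" for v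
  proof (rule ccontr)
    assume nin: "mat_of Z *v v \<notin> span {p}"
    then have "dim {mat_of Z *v v, p} = 2" using p by (simp add: dim_insert)
    moreover have "{mat_of Z *v v, p} \<subseteq> ?N"
      unfolding p_def using N[of v] N[of v0] by (simp only: insert_subset empty_subsetI simp_thms)
    then have "dim {mat_of Z *v v, p} \<le> dim ?N" by (rule dim_subset)
    ultimately show False using dN by linarith
  qed
  then have "\<exists>k. mat_of Z *v v = k *\<^sub>R p" for v by (auto simp: span_singleton)
  then obtain k where k: "\<And>v. mat_of Z *v v = k v *\<^sub>R p" by metis
  \<comment> \<open>Symmetry of \<open>Z\<close> determines the coefficient function
    \<open>k\<close> from its value at \<open>p\<close>.\<close>
  have kv: "k v * (p \<bullet> p) = k p * (v \<bullet> p)" for v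
    using mat_of_dot[of p Z v] by (simp add: k inner_commute)
  have q: "(v \<bullet> (mat_of Z *v v)) * (p \<bullet> p) = k p * (v \<bullet> p)\<^sup>2" for v
    using kv[of v] by (simp add: k power2_eq_square mult_ac)
  have "mat_of Z $ i $ i = axis i 1 \<bullet> (mat_of Z *v axis i 1)" for i
    by (simp add: matrix_vector_mult_basis inner_axis' column_def)
  then have "mat_of Z $ i $ i * (p \<bullet> p) = k p * (p $ i)\<^sup>2" for i
    using q[of "axis i 1"] by (simp add: inner_axis')
  then have "trace (mat_of Z) * (p \<bullet> p) = k p * (p \<bullet> p)"
    by (simp add: trace_def sum_distrib_right inner_vec_def[of p p] power2_eq_square flip: sum_distrib_left)
  then have "k p \<ge> 0" using tr p by simp
  then have "0 \<le> (v \<bullet> (mat_of Z *v v)) * (p \<bullet> p)" for v by (simp add: q)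
  then show ?thesis using p by (simp add: psd_cone_def zero_le_mult_iff) (metis inner_gt_zero_iff not_le)
qed

text \<open>The rank condition makes the range of \<open>X\<close> equal to the kernel of
  \<open>S\<close>, so the form of \<open>X\<close> is positive definite there; compactness of the
  unit sphere gives a uniform constant.\<close>

lemma strict_complementarity_coercive:
  fixes X S :: "'n::finite symmat"
  assumes X: "X \<in> psd_cone" and XS: "mat_of X ** mat_of S = 0"
    and rk: "rank (mat_of X) + rank (mat_of S) = CARD('n)"
  shows "\<exists>\<sigma>>0. \<forall>v. mat_of S *v v = 0 \<longrightarrow> \<sigma> * (norm v)\<^sup>2 \<le> v \<bullet> (mat_of X *v v)"
proof -
  let ?N = "{v. mat_of S *v v = 0}" and ?R = "range ((*v) (mat_of X))"
  have "subspace ?R"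
    using linear_subspace_image[OF matrix_vector_mul_linear subspace_UNIV] .
  moreover have "?R \<subseteq> ?N"
    using symmat_mult_eq_0_commute[OF XS] by (auto simp: matrix_vector_mul_assoc)
  moreover have "dim ?R = dim ?N"
    using symmat_rank_nullity[of S] rk by (simp add: rank_dim_range)
  ultimately have RN: "?R = ?N" by (intro subspace_dim_equal subspace_kernel) auto
  have pos: "0 < v \<bullet> (mat_of X *v v)" if "v \<in> ?N" "v \<noteq> 0" for v
  proof (rule ccontr)
    assume "\<not> 0 < v \<bullet> (mat_of X *v v)"
    then have "v \<bullet> (mat_of X *v v) = 0" using psd_coneD[OF X, of v] by linarith
    then have "mat_of X *v v = 0" using psd_vector_bound[OF X, of v] by simp
    moreover have "v \<in> ?R" using that(1) by (simp only: RN)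
    then obtain u where "v = mat_of X *v u" by (rule rangeE)
    ultimately have "v \<bullet> v = 0" by (metis mat_of_dot inner_zero_left)
    with that(2) show False by simp
  qed
  let ?C = "?N \<inter> sphere 0 1"
  have "compact ?C"
    by (intro closed_Int_compact closed_subspace subspace_kernel compact_sphere)
  show ?thesis
  proof (cases "?C = {}")
    \<comment> \<open>The kernel of \<open>S\<close> is trivial, so any positive constant
      works.\<close>
    case True
    have "v = 0" if "v \<in> ?N" for v
    proof (rule ccontr)
      assume "v \<noteq> 0"
      then have "(1 / norm v) *\<^sub>R v \<in> ?C" using that by (auto simp: matrix_vector_mult_scaleR)
      with True show False by blast
    qed
    then have "1 * (norm v)\<^sup>2 \<le> v \<bullet> (mat_of X *v v)" if "mat_of S *v v = 0" for v
      using that by (metis (mono_tags) mem_Collect_eq inner_zero_left norm_zero mult_1 order_refl zero_power2)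
    then show ?thesis using zero_less_one by blast
  next
    case False
    have "continuous_on ?C (\<lambda>v. v \<bullet> (mat_of X *v v))"
      by (intro continuous_on_inner continuous_on_id matrix_vector_mult_linear_continuous_on)
    then obtain w where w: "w \<in> ?C" "\<And>v. v \<in> ?C \<Longrightarrow> w \<bullet> (mat_of X *v w) \<le> v \<bullet> (mat_of X *v v)"
      using continuous_attains_inf[OF \<open>compact ?C\<close> False] by blast
    let ?s = "w \<bullet> (mat_of X *v w)"
    have "?s * (norm v)\<^sup>2 \<le> v \<bullet> (mat_of X *v v)" if v: "v \<in> ?N" for v
    proof (cases "v = 0")
      case False
      then have "(1 / norm v) *\<^sub>R v \<in> ?C" using v by (auto simp: matrix_vector_mult_scaleR)
      from w(2)[OF this] show ?thesis using False
        by (simp add: matrix_vector_mult_scaleR field_simps power2_eq_square)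
    qed simp
    moreover have "w \<noteq> 0" using w(1) by auto
    then have "?s > 0" using pos w(1) by blast
    ultimately show ?thesis by (intro exI[of _ ?s] conjI allI impI) simp_all
  qed
qed

section \<open>Error bound for the optimal face\<close>

text \<open>Split a vector along the range and the kernel of \<open>S\<close>: \<open>Z\<close>
  annihilates the range, so only the kernel part contributes.\<close>

lemma psd_if_psd_on_kernel:
  fixes Z S :: "'n::finite symmat"
  assumes ZS: "mat_of Z ** mat_of S = 0"
    and ker: "\<And>v. mat_of S *v v = 0 \<Longrightarrow> 0 \<le> v \<bullet> (mat_of Z *v v)"
  shows "Z \<in> psd_cone"
  unfolding psd_cone_def
proof (intro CollectI allI)
  fix v
  let ?R = "range ((*v) (mat_of S))"
  have sub: "subspace ?R"
    using linear_subspace_image[OF matrix_vector_mul_linear subspace_UNIV] .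
  obtain y z where yz: "y \<in> span ?R" "\<And>w. w \<in> span ?R \<Longrightarrow> orthogonal z w" "v = y + z"
    using orthogonal_subspace_decomp_exists[of ?R v] by metis
  have "y \<in> ?R" using yz(1) sub by (metis span_eq_iff)
  then obtain x where "y = mat_of S *v x" by (rule rangeE)
  then have Zy: "mat_of Z *v y = 0" by (simp add: matrix_vector_mul_assoc ZS)
  have "orthogonal z (mat_of S *v (mat_of S *v z))" by (intro yz(2) span_base rangeI)
  then have "(mat_of S *v z) \<bullet> (mat_of S *v z) = 0"
    unfolding orthogonal_def by (subst mat_of_dot[symmetric])
  then have "0 \<le> z \<bullet> (mat_of Z *v z)" by (intro ker) simp
  moreover have "mat_of Z *v v = mat_of Z *v z" by (simp add: yz(3) matrix_vector_right_distrib Zy)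
  moreover have "y \<bullet> (mat_of Z *v z) = 0" by (simp add: mat_of_dot Zy)
  ultimately show "0 \<le> v \<bullet> (mat_of Z *v v)" by (simp add: yz(3) inner_add_left)
qed

text \<open>Polarity needs testing only on the finitely many generators of \<open>Q\<close>, each
  giving a half-space.\<close>

lemma polyhedron_polar_constraint:
  fixes A :: "'a::euclidean_space \<Rightarrow> 'y::euclidean_space"
  assumes A: "linear A" and "convex_cone Q" "polyhedron Q"
  shows "polyhedron {X. b - A X \<in> polar_cone Q}"
proof -
  obtain V where V: "finite V" "V \<subseteq> Q" "convex_cone hull V = Q"
    using polyhedral_cone_finitely_generated assms(2,3) by blast
  have adj: "A X \<bullet> v = adjoint A v \<bullet> X" for X v
    by (metis A adjoint_works inner_commute)
  have "u \<in> polar_cone Q \<longleftrightarrow> (\<forall>v\<in>V. u \<bullet> v \<le> 0)" for u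
  proof
    assume "\<forall>v\<in>V. u \<bullet> v \<le> 0"
    then have "V \<subseteq> {x. u \<bullet> x \<le> 0}" by blast
    then have "convex_cone hull V \<subseteq> {x. u \<bullet> x \<le> 0}"
      by (rule hull_minimal) (rule convex_cone_halfspace_le)
    then show "u \<in> polar_cone Q" using V(3) by (auto simp: polar_cone_def)
  qed (use V(2) in \<open>auto simp: polar_cone_def\<close>)
  then have "{X. b - A X \<in> polar_cone Q} = \<Inter> ((\<lambda>v. {X. (- adjoint A v) \<bullet> X \<le> - (b \<bullet> v)}) ` V)"
    by (auto simp: inner_diff_left adj)
  then show ?thesis
    using V(1) by (auto simp only: intro!: polyhedron_Inter polyhedron_halfspace_le finite_imageI)
qed

lemma convex_polar_constraint:
  assumes "linear A" "b - A X \<in> polar_cone Q" "b - A Y \<in> polar_cone Q" "0 \<le> t" "t \<le> 1"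
  shows "b - A ((1 - t) *\<^sub>R X + t *\<^sub>R Y) \<in> polar_cone Q"
  unfolding polar_cone_def
proof (intro CollectI ballI)
  fix q assume q: "q \<in> Q"
  have "(b - A ((1 - t) *\<^sub>R X + t *\<^sub>R Y)) \<bullet> q = (1 - t) * ((b - A X) \<bullet> q) + t * ((b - A Y) \<bullet> q)"
    unfolding linear_add[OF assms(1)] linear_cmul[OF assms(1)]
    by (simp add: inner_diff_left inner_add_left algebra_simps)
  also have "\<dots> \<le> 0"
    using assms q by (intro add_nonpos_nonpos mult_nonneg_nonpos) (auto simp: polar_cone_def)
  finally show "(b - A ((1 - t) *\<^sub>R X + t *\<^sub>R Y)) \<bullet> q \<le> 0" .
qed

text \<open>Intersecting the polyhedron with the semidefinite cone costs only a constant factor: under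
  strict complementarity \<open>Xb\<close> is a Slater point relative to the face exposed by \<open>S\<close>, towards which
  \<open>Z\<close> is shifted; if the corank of \<open>S\<close> is at most one, the face is a ray, cut out by the sign of
  the trace.\<close>

lemma face_regularity:
  fixes S Xb :: "'n::finite symmat"
  assumes Xb: "Xb \<in> psd_cone" "mat_of Xb ** mat_of S = 0"
    and rk: "rank (mat_of S) \<ge> CARD('n) - 1 \<or> rank (mat_of Xb) + rank (mat_of S) = CARD('n)"
  shows "\<exists>M\<ge>0. \<forall>X Z. X \<in> psd_cone \<longrightarrow> norm X \<le> R \<longrightarrow> mat_of Z ** mat_of S = 0 \<longrightarrow>
    0 \<le> trace (mat_of Z) \<longrightarrow>
    (\<exists>t. 0 \<le> t \<and> t \<le> 1 \<and> (1 - t) *\<^sub>R Z + t *\<^sub>R Xb \<in> psd_cone \<and>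
       norm (X - ((1 - t) *\<^sub>R Z + t *\<^sub>R Xb)) \<le> M * norm (X - Z))"
  using rk
proof
  assume "rank (mat_of S) \<ge> CARD('n) - 1"
  then show ?thesis
    by (intro exI[of _ 1]) (auto intro!: exI[of _ 0] psd_if_trace_nonneg_corank_le_1[of _ S])
next
  assume "rank (mat_of Xb) + rank (mat_of S) = CARD('n)"
  from strict_complementarity_coercive[OF Xb this]
  obtain \<sigma> where \<sigma>: "\<sigma> > 0" "\<And>v. mat_of S *v v = 0 \<Longrightarrow> \<sigma> * (norm v)\<^sup>2 \<le> v \<bullet> (mat_of Xb *v v)"
    by blast
  \<comment> \<open>The distance from \<open>X\<close> to the shifted point is at most
    \<open>\<epsilon> + t * \<epsilon> + t * (\<bar>R\<bar> + norm Xb)\<close>, where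
    \<open>t \<le> 1\<close> and \<open>t \<le> \<epsilon> / \<sigma>\<close>.\<close>
  define M where "M = 2 + (\<bar>R\<bar> + norm Xb) / \<sigma>"
  have M: "M \<ge> 0" using \<sigma>(1) by (simp add: M_def)
  have "\<exists>t. 0 \<le> t \<and> t \<le> 1 \<and> (1 - t) *\<^sub>R Z + t *\<^sub>R Xb \<in> psd_cone \<and>
       norm (X - ((1 - t) *\<^sub>R Z + t *\<^sub>R Xb)) \<le> M * norm (X - Z)"
    if X: "X \<in> psd_cone" "norm X \<le> R" and Z: "mat_of Z ** mat_of S = 0" for X Z
  proof -
    define \<epsilon> where "\<epsilon> = norm (X - Z)"
    \<comment> \<open>Chosen so that \<open>(1 - t) * \<epsilon> = t * \<sigma>\<close>: on the
      kernel of \<open>S\<close> the form of \<open>Z\<close> is at least -\<open>\<epsilon>\<close>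
      times the squared norm, and the share of \<open>Xb\<close> compensates exactly.\<close>
    define t where "t = \<epsilon> / (\<epsilon> + \<sigma>)"
    have \<epsilon>: "\<epsilon> \<ge> 0" by (simp add: \<epsilon>_def)
    have t: "0 \<le> t" "t \<le> 1" using \<epsilon> \<sigma>(1) by (auto simp: t_def)
    have t\<sigma>: "t \<le> \<epsilon> / \<sigma>" using \<epsilon> \<sigma>(1) unfolding t_def by (intro divide_left_mono) auto
    have eq: "(1 - t) * \<epsilon> = t * \<sigma>" using \<epsilon> \<sigma>(1) by (simp add: t_def field_simps)
    let ?Z = "(1 - t) *\<^sub>R Z + t *\<^sub>R Xb"
    have "?Z \<in> psd_cone"
    proof (rule psd_if_psd_on_kernel)
      show "mat_of ?Z ** mat_of S = 0"
        using Z Xb(2) by (simp add: linear_add[OF linear_mat_of_mult] linear_cmul[OF linear_mat_of_mult])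
      fix v assume v: "mat_of S *v v = 0"
      have "v \<bullet> (mat_of (X - Z) *v v) \<le> \<epsilon> * (norm v)\<^sup>2"
        unfolding \<epsilon>_def by (rule quadratic_form_le)
      then have "- \<epsilon> * (norm v)\<^sup>2 \<le> v \<bullet> (mat_of Z *v v)"
        using psd_coneD[OF X(1), of v] by (simp add: mat_of_diff_vector inner_diff_right)
      then have "(1 - t) * (- \<epsilon> * (norm v)\<^sup>2) \<le> (1 - t) * (v \<bullet> (mat_of Z *v v))"
        using t by (intro mult_left_mono) auto
      moreover have "t * (\<sigma> * (norm v)\<^sup>2) \<le> t * (v \<bullet> (mat_of Xb *v v))"
        using t \<sigma>(2)[OF v] by (intro mult_left_mono) auto
      moreover have "(1 - t) * (- \<epsilon> * (norm v)\<^sup>2) + t * (\<sigma> * (norm v)\<^sup>2) = 0"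
        using arg_cong[OF eq, of "\<lambda>a. a * (norm v)\<^sup>2"] by (auto simp: mult_ac)
      ultimately show "0 \<le> v \<bullet> (mat_of ?Z *v v)"
        unfolding mat_of_add_vector mat_of_scaleR_vector inner_add_right inner_scaleR_right by linarith
    qed
    moreover have "norm (X - ?Z) \<le> M * \<epsilon>"
    proof -
      have "X - ?Z = (X - Z) + t *\<^sub>R ((Z - X) + (X - Xb))" by (simp add: algebra_simps)
      then have "norm (X - ?Z) \<le> norm (X - Z) + norm (t *\<^sub>R ((Z - X) + (X - Xb)))"
        by (metis norm_triangle_ineq)
      also have "norm (t *\<^sub>R ((Z - X) + (X - Xb))) \<le> t * (\<epsilon> + (\<bar>R\<bar> + norm Xb))"
      proof -
        have "norm ((Z - X) + (X - Xb)) \<le> norm (Z - X) + norm (X - Xb)" by (rule norm_triangle_ineq)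
        also have "norm (X - Xb) \<le> norm X + norm Xb" by (rule norm_triangle_ineq4)
        finally have "norm ((Z - X) + (X - Xb)) \<le> \<epsilon> + (\<bar>R\<bar> + norm Xb)"
          using X(2) by (simp add: \<epsilon>_def norm_minus_commute)
        then show ?thesis using t by (simp add: mult_left_mono)
      qed
      also have "t * (\<epsilon> + (\<bar>R\<bar> + norm Xb)) \<le> \<epsilon> + (\<epsilon> / \<sigma>) * (\<bar>R\<bar> + norm Xb)"
        unfolding distrib_left using t \<epsilon> t\<sigma>
        by (intro add_mono mult_right_mono) (auto simp: mult_left_le_one_le)
      finally show ?thesis by (simp add: M_def \<epsilon>_def field_simps)
    qed
    ultimately show ?thesis using t unfolding \<epsilon>_def by blast
  qed
  with M show ?thesis by blast
qed

text \<open>This becomes the zero set of \<open>T_phi\<close>. Apart from semidefiniteness every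
  condition is affine or polyhedral, which is why complementarity is stated by a matrix
  product.\<close>

definition kkt_face :: "('n::finite symmat \<Rightarrow> 'w) \<Rightarrow> ('n symmat \<Rightarrow> 'y::euclidean_space)
    \<Rightarrow> 'y \<Rightarrow> 'y set \<Rightarrow> 'w \<Rightarrow> 'y \<Rightarrow> 'n symmat \<Rightarrow> 'n symmat set" where
  "kkt_face F A b Q w y S = {X \<in> psd_cone. b - A X \<in> polar_cone Q \<and> F X = w \<and>
     y \<bullet> (A X - b) = 0 \<and> mat_of X ** mat_of S = 0}"

text \<open>Hoffman's bound produces a point \<open>Z\<close> satisfying all but the semidefinite
  constraint, and \<open>face_regularity\<close> repairs that. On bounded sets the squared residual
  of the equations is dominated by the expression on the right.\<close>

lemma kkt_face_error_bound:
  fixes F :: "'n::finite symmat \<Rightarrow> 'w::euclidean_space" and A :: "'n symmat \<Rightarrow> 'y::euclidean_space"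
  assumes F: "linear F" and A: "linear A" and Q: "convex_cone Q" "polyhedron Q"
    and S: "S \<in> psd_cone" and y: "y \<in> Q"
    and Xb: "Xb \<in> kkt_face F A b Q w y S"
    and rk: "rank (mat_of S) \<ge> CARD('n) - 1 \<or> rank (mat_of Xb) + rank (mat_of S) = CARD('n)"
  shows "\<exists>K\<ge>0. \<forall>X\<in>psd_cone. b - A X \<in> polar_cone Q \<longrightarrow> norm X \<le> R \<longrightarrow>
    (\<exists>P\<in>kkt_face F A b Q w y S.
       (norm (X - P))\<^sup>2 \<le> K * ((norm (F X - w))\<^sup>2 + y \<bullet> (A X - b) + S \<bullet> X))"
proof -
  have xb: "Xb \<in> psd_cone" "b - A Xb \<in> polar_cone Q" "F Xb = w" "y \<bullet> (A Xb - b) = 0"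
    "mat_of Xb ** mat_of S = 0" using Xb by (auto simp: kkt_face_def)
  \<comment> \<open>Collects the linear equations of the face.\<close>
  define T where "T X = (mat_of X ** mat_of S, F X, y \<bullet> A X)" for X
  have T: "linear T"
    unfolding T_def
    by (rule linearI)
       (auto simp: linear_add[OF linear_mat_of_mult] linear_cmul[OF linear_mat_of_mult]
         linear_add[OF F] linear_add[OF A] linear_cmul[OF F] linear_cmul[OF A] inner_add_right)
  \<comment> \<open>The trace half-space contains the semidefinite cone and supplies the sign
    condition that \<open>face_regularity\<close> requires of \<open>Z\<close>.\<close>
  let ?P = "{X. b - A X \<in> polar_cone Q} \<inter> {X. 0 \<le> trace (mat_of X)}"
  have poly: "polyhedron ?P"
    unfolding trace_eq_inner
    using polyhedron_polar_constraint[OF A Q]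
      polyhedron_halfspace_ge[where a = "symmat_of (mat 1) :: 'n symmat" and b = 0] by simp
  have XbP: "Xb \<in> ?P" using xb trace_psd_nonneg by auto
  obtain c where c: "c \<ge> 0"
    "\<And>X. X \<in> ?P \<Longrightarrow> \<exists>Z\<in>?P. T Z = T Xb \<and> norm (X - Z) \<le> c * norm (T X - T Xb)"
    using polyhedron_linear_error_bound[OF poly T XbP] by blast
  obtain M where M: "M \<ge> 0" "\<And>X Z. X \<in> psd_cone \<Longrightarrow> norm X \<le> R \<Longrightarrow> mat_of Z ** mat_of S = 0 \<Longrightarrow>
    0 \<le> trace (mat_of Z) \<Longrightarrow> \<exists>t. 0 \<le> t \<and> t \<le> 1 \<and> (1 - t) *\<^sub>R Z + t *\<^sub>R Xb \<in> psd_cone \<and>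
       norm (X - ((1 - t) *\<^sub>R Z + t *\<^sub>R Xb)) \<le> M * norm (X - Z)"
    using face_regularity[OF xb(1,5) rk, of R] by blast
  obtain K1 where K1: "K1 \<ge> 0"
    "\<And>X. X \<in> psd_cone \<Longrightarrow> (norm (mat_of X ** mat_of S))\<^sup>2 \<le> K1 * norm X * (S \<bullet> X)"
    using psd_product_bound[OF S] by blast
  obtain BA where BA: "BA > 0" "\<And>X. norm (A X) \<le> BA * norm X" using linear_bounded_pos[OF A] by blast
  \<comment> \<open>Bounds \<open>y \<bullet> (A X - b)\<close> for \<open>norm X \<le> R\<close>,
    so that its square is at most \<open>B\<close> times the term itself.\<close>
  define B where "B = norm y * (BA * \<bar>R\<bar> + norm b)"
  have B: "B \<ge> 0" using BA(1) by (simp add: B_def)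
  define K2 where "K2 = K1 * \<bar>R\<bar> + 1 + B"
  have "\<exists>P\<in>kkt_face F A b Q w y S.
       (norm (X - P))\<^sup>2 \<le> (M * c)\<^sup>2 * K2 * ((norm (F X - w))\<^sup>2 + y \<bullet> (A X - b) + S \<bullet> X)"
    if X: "X \<in> psd_cone" "b - A X \<in> polar_cone Q" "norm X \<le> R" for X
  proof -
    let ?r = "(norm (F X - w))\<^sup>2 + y \<bullet> (A X - b) + S \<bullet> X"
    have y0: "0 \<le> y \<bullet> (A X - b)"
      using X(2) y by (auto simp: polar_cone_def inner_diff_left inner_diff_right inner_commute)
    have S0: "0 \<le> S \<bullet> X" using psd_inner_nonneg S X(1) by blast
    obtain Z where Z: "Z \<in> ?P" "T Z = T Xb" "norm (X - Z) \<le> c * norm (T X - T Xb)"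
      using c(2)[of X] X trace_psd_nonneg by auto
    have TZ: "mat_of Z ** mat_of S = 0" "F Z = w" "y \<bullet> (A Z - b) = 0"
      using Z(2) xb by (auto simp: T_def inner_diff_right)
    obtain t where t: "0 \<le> t" "t \<le> 1" "(1 - t) *\<^sub>R Z + t *\<^sub>R Xb \<in> psd_cone"
      "norm (X - ((1 - t) *\<^sub>R Z + t *\<^sub>R Xb)) \<le> M * norm (X - Z)"
      using M(2)[OF X(1,3) TZ(1)] Z(1) by auto
    let ?Z = "(1 - t) *\<^sub>R Z + t *\<^sub>R Xb"
    have "b - A ?Z \<in> polar_cone Q" using Z(1) xb(2) t by (intro convex_polar_constraint[OF A]) auto
    moreover have "F ?Z = w"
      using TZ(2) xb(3) by (simp add: linear_add[OF F] linear_cmul[OF F] flip: scaleR_add_left)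
    moreover have "y \<bullet> (A ?Z - b) = (1 - t) * (y \<bullet> (A Z - b)) + t * (y \<bullet> (A Xb - b))"
      unfolding linear_add[OF A] linear_cmul[OF A]
      by (simp add: inner_diff_right inner_add_right algebra_simps)
    moreover have "mat_of ?Z ** mat_of S = 0"
      using TZ(1) xb(5) by (simp add: linear_add[OF linear_mat_of_mult] linear_cmul[OF linear_mat_of_mult])
    ultimately have mem: "?Z \<in> kkt_face F A b Q w y S"
      using t(3) TZ(3) xb(4) by (simp add: kkt_face_def)
    have "norm (X - ?Z) \<le> M * c * norm (T X - T Xb)"
      using t(4) mult_left_mono[OF Z(3) M(1)] by (simp add: mult.assoc)
    then have "(norm (X - ?Z))\<^sup>2 \<le> (M * c)\<^sup>2 * (norm (T X - T Xb))\<^sup>2"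
      by (metis norm_ge_zero power_mono power_mult_distrib)
    also have "(norm (T X - T Xb))\<^sup>2 \<le> K2 * ?r"
    proof -
      have "y \<bullet> (A X - A Xb) = y \<bullet> (A X - b)" using xb(4) by (simp add: inner_diff_right)
      then have "(norm (T X - T Xb))\<^sup>2 =
          (norm (mat_of X ** mat_of S))\<^sup>2 + ((norm (F X - w))\<^sup>2 + (y \<bullet> (A X - b))\<^sup>2)"
        using xb by (simp add: T_def norm_Pair inner_diff_right[symmetric])
      moreover have "(norm (mat_of X ** mat_of S))\<^sup>2 \<le> K1 * \<bar>R\<bar> * (S \<bullet> X)"
      proof -
        have "K1 * norm X \<le> K1 * \<bar>R\<bar>" using X(3) K1(1) by (intro mult_left_mono) auto
        from mult_right_mono[OF this S0] K1(2)[OF X(1)] show ?thesis by linarith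
      qed
      moreover have "(y \<bullet> (A X - b))\<^sup>2 \<le> B * (y \<bullet> (A X - b))"
      proof -
        have "norm (A X - b) \<le> norm (A X) + norm b" by (rule norm_triangle_ineq4)
        also have "norm (A X) \<le> BA * \<bar>R\<bar>"
          using BA(2)[of X] mult_left_mono[of "norm X" "\<bar>R\<bar>" BA] BA(1) X(3) by linarith
        finally have "norm y * norm (A X - b) \<le> B" by (simp add: B_def mult_left_mono)
        then have "y \<bullet> (A X - b) \<le> B" using norm_cauchy_schwarz[of y "A X - b"] by linarith
        then show ?thesis using y0 by (simp add: power2_eq_square mult_right_mono)
      qed
      moreover have "K2 * ?r = K1 * \<bar>R\<bar> * (S \<bullet> X) + (norm (F X - w))\<^sup>2 + B * (y \<bullet> (A X - b))
          + (K1 * \<bar>R\<bar> + B) * (norm (F X - w))\<^sup>2 + (K1 * \<bar>R\<bar> + 1) * (y \<bullet> (A X - b)) + (1 + B) * (S \<bullet> X)"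
        by (simp add: K2_def algebra_simps)
      moreover have "0 \<le> (K1 * \<bar>R\<bar> + B) * (norm (F X - w))\<^sup>2" "0 \<le> (K1 * \<bar>R\<bar> + 1) * (y \<bullet> (A X - b))"
        "0 \<le> (1 + B) * (S \<bullet> X)"
        using B K1(1) y0 S0 by simp_all
      ultimately show ?thesis by linarith
    qed
    finally show ?thesis using mem by (auto simp: mult.assoc mult_left_mono intro!: bexI[of _ ?Z])
  qed
  moreover have "(M * c)\<^sup>2 * K2 \<ge> 0" using B K1(1) by (simp add: K2_def)
  ultimately show ?thesis by blast
qed

section \<open>Conjugates and the dual function\<close>

lemma edom_real:
  assumes "\<forall>w. h w \<noteq> -\<infinity>" "w \<in> edom h"
  shows "h w = ereal (real_of_ereal (h w))"
  using assms by (cases "h w") (auto simp: edom_def)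

text \<open>By convexity the difference quotients towards \<open>x\<close> are at most
  \<open>h x - h w\<close>; let the step tend to 0 from the right. Outside the domain the right-hand
  side is infinite.\<close>

lemma gradient_inequality:
  fixes h :: "'w::euclidean_space \<Rightarrow> ereal"
  assumes fin: "\<forall>w. h w \<noteq> -\<infinity>" and cvx: "convex (edom h)" and str: "strictly_convex_on (edom h) h"
    and w: "w \<in> edom h" and g: "GDERIV (\<lambda>u. real_of_ereal (h u)) w :> g"
  shows "h w + ereal (g \<bullet> (x - w)) \<le> h x"
proof (cases "x \<in> edom h \<and> x \<noteq> w")
  case False
  then show ?thesis by (cases "x = w") (auto simp: edom_def)
next
  case True
  let ?r = "\<lambda>u. real_of_ereal (h u)"
  let ?d = "x - w"
  have quot: "(?r (w + t *\<^sub>R ?d) - ?r w) / t \<le> ?r x - ?r w" if t: "0 < t" "t < 1" for t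
  proof -
    let ?z = "(1 - t) *\<^sub>R w + t *\<^sub>R x"
    have z: "?z \<in> edom h" using cvx w True t by (intro convexD_alt) auto
    have "h ?z < ereal (1 - t) * h w + ereal t * h x"
      using str[unfolded strictly_convex_on_def, rule_format, of w x t] w True t by blast
    then have "ereal (?r ?z) < ereal (1 - t) * ereal (?r w) + ereal t * ereal (?r x)"
      using edom_real[OF fin] w z True by metis
    then have "?r ?z < (1 - t) * ?r w + t * ?r x" by simp
    moreover have "?z = w + t *\<^sub>R ?d" by (simp add: algebra_simps)
    ultimately have "?r (w + t *\<^sub>R ?d) - ?r w \<le> t * (?r x - ?r w)" by (simp add: algebra_simps)
    then show ?thesis using t by (simp add: field_simps)
  qed
  have "((\<lambda>t. w + t *\<^sub>R ?d) has_derivative (\<lambda>t. t *\<^sub>R ?d)) (at 0)"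
    by (auto intro!: derivative_eq_intros)
  moreover have "(?r has_derivative (\<lambda>u. u \<bullet> g)) (at (w + 0 *\<^sub>R ?d))"
    using g by (simp add: gderiv_def)
  ultimately have "((\<lambda>t. ?r (w + t *\<^sub>R ?d)) has_derivative (\<lambda>t. (t *\<^sub>R ?d) \<bullet> g)) (at 0)"
    by (rule has_derivative_compose)
  moreover have "(\<lambda>t. (t *\<^sub>R ?d) \<bullet> g) = (*) (?d \<bullet> g)" by (auto simp: mult.commute)
  ultimately have "((\<lambda>t. ?r (w + t *\<^sub>R ?d)) has_field_derivative (?d \<bullet> g)) (at 0)"
    by (simp add: has_field_derivative_def)
  then have "((\<lambda>t. (?r (w + t *\<^sub>R ?d) - ?r w) / t) \<longlongrightarrow> ?d \<bullet> g) (at 0)"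
    by (simp add: DERIV_def)
  then have "((\<lambda>t. (?r (w + t *\<^sub>R ?d) - ?r w) / t) \<longlongrightarrow> ?d \<bullet> g) (at_right 0)"
    by (rule tendsto_mono[rotated]) (simp add: at_le)
  moreover have "eventually (\<lambda>t. (?r (w + t *\<^sub>R ?d) - ?r w) / t \<le> ?r x - ?r w) (at_right 0)"
    using quot by (auto simp: eventually_at_right_field intro!: exI[of _ 1])
  ultimately have "?d \<bullet> g \<le> ?r x - ?r w"
    by (rule tendsto_upperbound) simp
  then have "ereal (?r w) + ereal (g \<bullet> ?d) \<le> ereal (?r x)" by (simp add: inner_commute)
  then show ?thesis using edom_real[OF fin] w True by metis
qed

lemma Fenchel_Young: "ereal (v \<bullet> x) - h x \<le> conjugate h v"
  unfolding conjugate_def by (rule SUP_upper) simp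

text \<open>A subgradient attains equality in the Fenchel-Young inequality.\<close>

lemma conjugate_eq:
  assumes "h w = ereal \<eta>" and "\<And>x. h w + ereal (g \<bullet> (x - w)) \<le> h x"
  shows "conjugate h g = ereal (g \<bullet> w - \<eta>)"
proof (rule antisym)
  show "conjugate h g \<le> ereal (g \<bullet> w - \<eta>)"
    unfolding conjugate_def
  proof (rule SUP_least)
    fix x
    show "ereal (g \<bullet> x) - h x \<le> ereal (g \<bullet> w - \<eta>)"
      using assms(2)[of x] by (cases "h x") (auto simp: assms(1) inner_diff_right)
  qed
  show "ereal (g \<bullet> w - \<eta>) \<le> conjugate h g"
    using Fenchel_Young[of g w h] by (simp add: assms(1))
qed

text \<open>The function \<open>h\<close> minus the linear form of \<open>v\<close> has a local
  minimum at \<open>w\<close>, interior to the domain, so its derivative vanishes there.\<close>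

lemma subgradient_eq_gradient:
  fixes h :: "'w::euclidean_space \<Rightarrow> ereal"
  assumes fin: "\<forall>w. h w \<noteq> -\<infinity>" and op: "open (edom h)" and w: "w \<in> edom h"
    and g: "GDERIV (\<lambda>u. real_of_ereal (h u)) w :> g"
    and sub: "\<And>x. h w + ereal (v \<bullet> (x - w)) \<le> h x"
  shows "v = g"
proof -
  let ?r = "\<lambda>u. real_of_ereal (h u)"
  have der: "((\<lambda>u. ?r u - v \<bullet> u) has_derivative (\<lambda>u. u \<bullet> g - v \<bullet> u)) (at w)"
    using g unfolding gderiv_def by (auto intro!: derivative_eq_intros)
  obtain e where e: "e > 0" "ball w e \<subseteq> edom h" using op w open_contains_ball by blast
  have "?r w - v \<bullet> w \<le> ?r u - v \<bullet> u" if "u \<in> ball w e" for u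
  proof -
    have "ereal (?r w) + ereal (v \<bullet> (u - w)) \<le> ereal (?r u)"
      using sub[of u] edom_real[OF fin] w that e(2) by (metis subsetD)
    then show ?thesis by (simp add: inner_diff_right)
  qed
  then have "(\<lambda>u. u \<bullet> g - v \<bullet> u) = (\<lambda>u. 0)"
    using differential_zero_maxmin[of w "ball w e" "\<lambda>u. ?r u - v \<bullet> u" "\<lambda>u. u \<bullet> g - v \<bullet> u"] der e(1) by auto
  \<comment> \<open>The zero derivative is evaluated in the direction \<open>g - v\<close>.\<close>
  then have "(g - v) \<bullet> g - v \<bullet> (g - v) = 0" by metis
  then have "(g - v) \<bullet> (g - v) = 0" by (simp add: algebra_simps inner_commute)
  then show ?thesis by simp
qed

text \<open>Testing the subgradient inequality of the conjugate at \<open>g\<close>, where its value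
  is known, forces equality in Fenchel-Young at \<open>v\<close> and \<open>w\<close>. So
  \<open>v\<close> is a subgradient of \<open>h\<close> at \<open>w\<close>; no biconjugate is
  involved.\<close>

lemma conjugate_subgradient_eq_gradient:
  fixes h :: "'w::euclidean_space \<Rightarrow> ereal"
  assumes fin: "\<forall>w. h w \<noteq> -\<infinity>" and op: "open (edom h)" and w: "w \<in> edom h"
    and g: "GDERIV (\<lambda>u. real_of_ereal (h u)) w :> g"
    and gi: "\<And>x. h w + ereal (g \<bullet> (x - w)) \<le> h x"
    and sub: "w \<in> subdifferential (conjugate h) v"
  shows "v = g"
proof -
  obtain \<eta> where \<eta>: "h w = ereal \<eta>" using edom_real[OF fin w] by blast
  have "\<bar>conjugate h v\<bar> \<noteq> \<infinity>" and *: "conjugate h v + ereal (w \<bullet> (g - v)) \<le> conjugate h g"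
    using sub by (auto simp: subdifferential_def split: if_splits)
  then obtain c where c: "conjugate h v = ereal c" by (cases "conjugate h v") auto
  have c_le: "c \<le> v \<bullet> w - \<eta>"
    using * unfolding c conjugate_eq[OF \<eta> gi] by (simp add: inner_diff_right inner_commute)
  have "h w + ereal (v \<bullet> (x - w)) \<le> h x" for x
    using Fenchel_Young[of v x h] c_le fin
    by (cases "h x") (auto simp: c \<eta> inner_diff_right)
  then show ?thesis using subgradient_eq_gradient[OF fin op w g] by blast
qed

lemma normal_cone_convex_cone:
  assumes "convex_cone K"
  shows "v \<in> normal_cone K x \<longleftrightarrow> x \<in> K \<and> v \<in> polar_cone K \<and> v \<bullet> x = 0"
proof
  assume v: "v \<in> normal_cone K x"
  then have x: "x \<in> K" and n: "\<And>y. y \<in> K \<Longrightarrow> v \<bullet> (y - x) \<le> 0"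
    by (auto simp: normal_cone_def split: if_splits)
  have "v \<bullet> y \<le> 0" if "y \<in> K" for y
    using n[of "y + x"] convex_cone_add[OF assms that x] by simp
  moreover have "0 \<le> v \<bullet> x"
    using n[of 0] convex_cone_contains_0[OF assms] by (simp add: inner_diff_right)
  ultimately show "x \<in> K \<and> v \<in> polar_cone K \<and> v \<bullet> x = 0"
    using x by (auto simp: polar_cone_def intro: antisym)
qed (auto simp: normal_cone_def polar_cone_def inner_diff_right)

section \<open>The dual function and its finiteness\<close>

lemma lagrangian_eq:
  assumes "linear F" "linear A"
  shows "lagrangian h F A C b Q (y, w, S) X =
    indicator_fn Q y - ereal (b \<bullet> y) + conjugate h (- w) + indicator_fn psd_cone S
      + ereal (A X \<bullet> y + F X \<bullet> w + X \<bullet> S - C \<bullet> X)"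
  by (simp add: lagrangian_def dual_objective_def dual_residual_def inner_add_right inner_diff_right
      adjoint_works[OF assms(1)] adjoint_works[OF assms(2)] inner_commute[of C])

text \<open>The dual point \<open>(0, - g, 0)\<close> is inserted into the infimum.\<close>

lemma phi_upper:
  assumes lin: "linear F" "linear A" and Q: "convex_cone Q"
    and \<eta>: "h (F X) = ereal \<eta>" and gi: "\<And>x. h (F X) + ereal (g \<bullet> (x - F X)) \<le> h x"
  shows "phi h F A C b Q X \<le> ereal (- (\<eta> + C \<bullet> X))"
proof -
  have "phi h F A C b Q X \<le> lagrangian h F A C b Q (0, - g, 0) X"
    unfolding phi_def by (rule INF_lower) simp
  also have "\<dots> = ereal (- (\<eta> + C \<bullet> X))"
    using convex_cone_contains_0[OF Q] convex_cone_contains_0[OF convex_cone_psd]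
    by (simp add: lagrangian_eq[OF lin] conjugate_eq[OF \<eta> gi] indicator_fn_def inner_commute
        flip: zero_ereal_def)
  finally show ?thesis .
qed

text \<open>Weak duality: feasibility of \<open>X\<close> gives the signs of the terms in
  \<open>y\<close> and \<open>S\<close>, and Fenchel-Young bounds the term in
  \<open>w\<close>.\<close>

lemma phi_lower:
  fixes h :: "'w::euclidean_space \<Rightarrow> ereal" and F :: "'n::finite symmat \<Rightarrow> 'w"
    and A :: "'n symmat \<Rightarrow> 'y::euclidean_space"
  assumes lin: "linear F" "linear A" and X: "X \<in> psd_cone" "b - A X \<in> polar_cone Q"
    and \<eta>: "h (F X) = ereal \<eta>"
  shows "ereal (- (\<eta> + C \<bullet> X)) \<le> phi h F A C b Q X"
  unfolding phi_def
proof (rule INF_greatest)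
  fix z :: "'y \<times> 'w \<times> 'n symmat"
  obtain y w S where z: "z = (y, w, S)" by (cases z)
  show "ereal (- (\<eta> + C \<bullet> X)) \<le> lagrangian h F A C b Q z X"
  proof (cases "y \<in> Q \<and> S \<in> psd_cone")
    case True
    then have "b \<bullet> y \<le> A X \<bullet> y" "0 \<le> X \<bullet> S"
      using X psd_inner_nonneg by (auto simp: polar_cone_def inner_diff_left)
    moreover have "ereal (- w \<bullet> F X - \<eta>) \<le> conjugate h (- w)"
      using Fenchel_Young[of "- w" "F X" h] by (simp add: \<eta>)
    ultimately show ?thesis
      using True by (cases "conjugate h (- w)")
        (auto simp: z lagrangian_eq[OF lin] indicator_fn_def inner_diff_left inner_commute)
  next
    case False
    \<comment> \<open>Excludes a sum of opposite infinities, so the infinite indicator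
      prevails.\<close>
    have "conjugate h (- w) \<noteq> -\<infinity>" using Fenchel_Young[of "- w" "F X" h] by (auto simp: \<eta>)
    then have "lagrangian h F A C b Q z X = \<infinity>"
      using False by (cases "conjugate h (- w)") (auto simp: z lagrangian_eq[OF lin] indicator_fn_def)
    then show ?thesis by simp
  qed
qed

lemma nonneg_if_affine_bounded_below:
  fixes a c p :: real
  assumes "\<And>t. 0 \<le> t \<Longrightarrow> p \<le> c + t * a"
  shows "0 \<le> a"
proof (rule ccontr)
  assume a: "\<not> 0 \<le> a"
  \<comment> \<open>At this \<open>t\<close> the affine function equals
    \<open>c - \<bar>c - p\<bar> - 1\<close>, which is less than \<open>p\<close>.\<close>
  define t where "t = (\<bar>c - p\<bar> + 1) / (- a)"
  have "0 \<le> t" using a unfolding t_def by (intro divide_nonneg_pos) auto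
  moreover have "t * a = - (\<bar>c - p\<bar> + 1)" using a by (simp add: t_def)
  ultimately show False using assms[of t] by linarith
qed

text \<open>Starting from a dual point with finite conjugate, moving along a ray of \<open>Q\<close>
  or of the semidefinite cone would send the Lagrangian to minus infinity if the corresponding
  constraint failed.\<close>

lemma phi_finite_imp_feasible:
  assumes lin: "linear F" "linear A" and Q: "convex_cone Q" and conj: "conjugate h v = ereal c"
    and fin: "\<bar>phi h F A C b Q X\<bar> \<noteq> \<infinity>"
  shows "X \<in> psd_cone" "b - A X \<in> polar_cone Q"
proof -
  obtain p where p: "phi h F A C b Q X = ereal p" using fin by (cases "phi h F A C b Q X") auto
  have le: "p \<le> - (b \<bullet> y) + c + (A X \<bullet> y - F X \<bullet> v + X \<bullet> S - C \<bullet> X)"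
    if "y \<in> Q" "S \<in> psd_cone" for y S
  proof -
    have "ereal p \<le> lagrangian h F A C b Q (y, - v, S) X"
      unfolding p[symmetric] phi_def by (rule INF_lower) simp
    then show ?thesis using that by (simp add: lagrangian_eq[OF lin] indicator_fn_def conj flip: zero_ereal_def)
  qed
  show "X \<in> psd_cone"
    unfolding psd_cone_def
  proof (intro CollectI allI)
    fix u
    show "0 \<le> u \<bullet> (mat_of X *v u)"
    proof (rule nonneg_if_affine_bounded_below)
      fix t :: real assume "0 \<le> t"
      then have "t *\<^sub>R outer u \<in> psd_cone" by (intro convex_cone_scaleR convex_cone_psd outer_psd)
      from le[OF convex_cone_contains_0[OF Q] this]
      show "p \<le> (c - F X \<bullet> v - C \<bullet> X) + t * (u \<bullet> (mat_of X *v u))" by (simp add: inner_outer)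
    qed
  qed
  show "b - A X \<in> polar_cone Q"
    unfolding polar_cone_def
  proof (intro CollectI ballI)
    fix y assume y: "y \<in> Q"
    have "0 \<le> A X \<bullet> y - b \<bullet> y"
    proof (rule nonneg_if_affine_bounded_below)
      fix t :: real assume "0 \<le> t"
      then have "t *\<^sub>R y \<in> Q" using Q y by (simp add: convex_cone_scaleR)
      from le[OF this convex_cone_contains_0[OF convex_cone_psd]]
      show "p \<le> (c - F X \<bullet> v - C \<bullet> X) + t * (A X \<bullet> y - b \<bullet> y)" by (simp add: right_diff_distrib)
    qed
    then show "(b - A X) \<bullet> y \<le> 0" by (simp add: inner_diff_left)
  qed
qed

text \<open>For fixed \<open>z\<close> the Lagrangian is affine in \<open>X\<close>. Stating
  concavity through superlevel sets avoids arithmetic with infinite values.\<close>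

lemma phi_superlevel_convex:
  assumes "ereal p \<le> phi h F A C b Q X" "ereal p \<le> phi h F A C b Q Y" "0 \<le> t" "t \<le> 1"
  shows "ereal p \<le> phi h F A C b Q ((1 - t) *\<^sub>R X + t *\<^sub>R Y)"
  unfolding phi_def
proof (rule INF_greatest)
  fix z
  let ?L = "lagrangian h F A C b Q z" and ?r = "dual_residual F A C z"
  have X: "ereal p \<le> ?L X" and Y: "ereal p \<le> ?L Y"
    using order_trans[OF assms(1)[unfolded phi_def] INF_lower] order_trans[OF assms(2)[unfolded phi_def] INF_lower]
    by auto
  show "ereal p \<le> ?L ((1 - t) *\<^sub>R X + t *\<^sub>R Y)"
  proof (cases "dual_objective h b Q z")
    case (real d)
    then have "p \<le> d + X \<bullet> ?r" "p \<le> d + Y \<bullet> ?r" using X Y by (simp_all add: lagrangian_def)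
    then have "(1 - t) * p + t * p \<le> (1 - t) * (d + X \<bullet> ?r) + t * (d + Y \<bullet> ?r)"
      using assms(3,4) by (intro add_mono mult_left_mono) auto
    then show ?thesis by (simp add: lagrangian_def real inner_add_left algebra_simps)
  qed (use X in \<open>simp_all add: lagrangian_def\<close>)
qed

section \<open>Zeros of \<open>T_phi\<close>, multipliers and subregularity\<close>

lemma T_phi_iff:
  "V \<in> T_phi h F A C b Q X \<longleftrightarrow> \<bar>phi h F A C b Q X\<bar> \<noteq> \<infinity> \<and>
     (\<forall>Y. - phi h F A C b Q X + ereal (V \<bullet> (Y - X)) \<le> - phi h F A C b Q Y)"
  by (simp add: T_phi_def subdifferential_def)

lemma zero_in_T_phi_iff:
  "0 \<in> T_phi h F A C b Q X \<longleftrightarrow> \<bar>phi h F A C b Q X\<bar> \<noteq> \<infinity> \<and> (\<forall>Y. phi h F A C b Q Y \<le> phi h F A C b Q X)"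
  by (simp add: T_phi_iff flip: zero_ereal_def)

text \<open>The normal cone to a cone splits into polarity and complementarity; \<open>X\<close> is
  semidefinite because it pairs nonnegatively with every rank-one matrix.\<close>

lemma multipliersD:
  fixes h :: "'w::euclidean_space \<Rightarrow> ereal"
  assumes "(y, w, S) \<in> multipliers h F A C b Q X" and "convex_cone Q"
  shows "y \<in> Q" "b - A X \<in> polar_cone Q" "y \<bullet> (A X - b) = 0" "S \<in> psd_cone" "X \<in> psd_cone"
    "S \<bullet> X = 0" "F X \<in> subdifferential (conjugate h) (- w)" "adjoint A y + adjoint F w + S = C"
proof -
  have 1: "b - A X \<in> normal_cone Q y" and 2: "F X \<in> subdifferential (conjugate h) (- w)"
    and 3: "- X \<in> normal_cone psd_cone S" and 4: "adjoint A y + adjoint F w + S = C"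
    using assms(1) by (auto simp: multipliers_def image_iff algebra_simps) (metis add_eq_0_iff add.commute)
  note 1 = 1[unfolded normal_cone_convex_cone[OF assms(2)]]
    and 3 = 3[unfolded normal_cone_convex_cone[OF convex_cone_psd]]
  show "y \<in> Q" "b - A X \<in> polar_cone Q" "S \<in> psd_cone" using 1 3 by blast+
  show "y \<bullet> (A X - b) = 0" using 1 by (simp add: inner_diff_left inner_diff_right inner_commute)
  show "S \<bullet> X = 0" using 3 by (simp add: inner_commute)
  have "- X \<in> polar_cone psd_cone" using 3 by blast
  then have "0 \<le> X \<bullet> outer v" for v using outer_psd[of v] by (auto simp: polar_cone_def)
  then show "X \<in> psd_cone" by (simp add: psd_cone_def inner_outer)
  show "F X \<in> subdifferential (conjugate h) (- w)" "adjoint A y + adjoint F w + S = C" using 2 4 .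
qed

text \<open>Reduces the set distances to a bound for each element \<open>v\<close> of
  \<open>G x\<close>.\<close>

lemma metrically_subregular_if_error_bound:
  fixes G :: "'a::real_inner \<Rightarrow> 'a set"
  assumes zero: "0 \<in> G x0" and U: "open U" "x0 \<in> U" and K: "0 < K"
    and bound: "\<And>x v. x \<in> U \<Longrightarrow> v \<in> G x \<Longrightarrow> \<exists>p. 0 \<in> G p \<and> norm (x - p) \<le> K * norm v"
  shows "metrically_subregular G x0 0"
  unfolding metrically_subregular_def
proof (intro conjI exI[of _ K] exI[of _ U] ballI)
  fix x assume x: "x \<in> U"
  show "set_distance x {x'. 0 \<in> G x'} \<le> ereal K * set_distance 0 (G x)"
  proof (cases "G x = {}")
    \<comment> \<open>The distance to the empty value is infinite, and \<open>K > 0\<close> keeps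
      the product infinite.\<close>
    case True
    then show ?thesis using K by (simp add: set_distance_def top_ereal_def)
  next
    case False
    have "set_distance x {x'. 0 \<in> G x'} / ereal K \<le> set_distance 0 (G x)"
      unfolding set_distance_def[of 0]
    proof (rule INF_greatest)
      fix v assume v: "v \<in> G x"
      obtain p where p: "0 \<in> G p" "norm (x - p) \<le> K * norm v" using bound[OF x v] by blast
      have "set_distance x {x'. 0 \<in> G x'} \<le> ereal (dist x p)"
        unfolding set_distance_def using p(1) by (intro INF_lower) simp
      also have "\<dots> \<le> ereal K * ereal (dist 0 v)" using p(2) by (simp add: dist_norm)
      finally show "set_distance x {x'. 0 \<in> G x'} / ereal K \<le> ereal (dist 0 v)"
        using K by (simp add: ereal_divide_le_pos)
    qed
    then show ?thesis using K by (simp add: ereal_divide_le_pos)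
  qed
qed (use assms in auto)

section \<open>Metric subregularity\<close>

lemma dual_feasible_inner:
  fixes F :: "'n::finite symmat \<Rightarrow> 'w::euclidean_space" and A :: "'n symmat \<Rightarrow> 'y::euclidean_space"
  assumes "linear F" "linear A" "adjoint A y + adjoint F w + S = C"
  shows "C \<bullet> X = y \<bullet> A X + w \<bullet> F X + S \<bullet> X"
proof -
  have "adjoint A y \<bullet> X = y \<bullet> A X" "adjoint F w \<bullet> X = w \<bullet> F X"
    using assms(1,2) by (simp_all add: adjoint_works inner_commute[of _ X] inner_commute[of _ "_ X"])
  then show ?thesis unfolding assms(3)[symmetric] by (simp add: inner_add_left)
qed

text \<open>\<open>phi_upper\<close> bounds \<open>phi\<close> by minus the primal objective.
  Writing \<open>C\<close> through dual feasibility cancels the linear term in \<open>F X\<close>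
  against the one in \<open>quad\<close> and leaves the three gap terms.\<close>

lemma phi_local_growth:
  fixes h :: "'w::euclidean_space \<Rightarrow> ereal" and F :: "'n::finite symmat \<Rightarrow> 'w"
    and A :: "'n symmat \<Rightarrow> 'y::euclidean_space"
  assumes lin: "linear F" "linear A" and Q: "convex_cone Q"
    and fin: "\<forall>w. h w \<noteq> -\<infinity>" and FX: "F X \<in> edom h"
    and gi: "\<And>x. h (F X) + ereal (g \<bullet> (x - F X)) \<le> h x"
    and w0: "h w0 = ereal \<eta>"
    and C: "adjoint A y + adjoint F w + S = C"
    and quad: "h w0 + ereal (- w \<bullet> (F X - w0) + \<kappa> * (norm (F X - w0))\<^sup>2) \<le> h (F X)"
  shows "phi h F A C b Q X \<le> ereal (- (\<eta> + w \<bullet> w0 + y \<bullet> b)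
    - (\<kappa> * (norm (F X - w0))\<^sup>2 + y \<bullet> (A X - b) + S \<bullet> X))"
proof -
  obtain r where r: "h (F X) = ereal r" using edom_real[OF fin FX] by blast
  have "C \<bullet> X = y \<bullet> A X + w \<bullet> F X + S \<bullet> X" using dual_feasible_inner[OF lin C] .
  moreover have "\<eta> - w \<bullet> (F X - w0) + \<kappa> * (norm (F X - w0))\<^sup>2 \<le> r"
    using quad by (simp add: r w0)
  ultimately have "- (r + C \<bullet> X) \<le> - (\<eta> + w \<bullet> w0 + y \<bullet> b)
    - (\<kappa> * (norm (F X - w0))\<^sup>2 + y \<bullet> (A X - b) + S \<bullet> X)"
    by (simp add: inner_diff_right)
  with phi_upper[OF lin Q r gi] show ?thesis by (meson ereal_less_eq(3) order_trans)
qed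

theorem corollary3p1:
  fixes h :: "'w::euclidean_space \<Rightarrow> ereal"
    and grad_h :: "'w \<Rightarrow> 'w"
    and F :: "'n::finite symmat \<Rightarrow> 'w"
    and A :: "'n symmat \<Rightarrow> 'y::euclidean_space"
    and C :: "'n symmat"
    and b :: 'y
    and Q :: "'y set"
  assumes "linear F" and "linear A"
    and "convex_cone Q" and "polyhedron Q"
    and "\<forall>w. h w \<noteq> -\<infinity>"
    and "edom h \<noteq> {}" and "open (edom h)" and "convex (edom h)"
    and "\<forall>w\<in>edom h. GDERIV (\<lambda>u. real_of_ereal (h u)) w :> grad_h w"
    and "continuous_on (edom h) grad_h"
    and "\<forall>D. D \<subseteq> edom h \<longrightarrow> convex D \<longrightarrow> strictly_convex_on D h"
    and "\<forall>w\<in>edom h. \<exists>\<kappa>\<^sub>1>0. \<exists>W. open W \<and> w \<in> W \<and>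
           (\<forall>w'\<in>W. h w + ereal (grad_h w \<bullet> (w' - w) + \<kappa>\<^sub>1 * (norm (w' - w))\<^sup>2) \<le> h w')"
    and "(\<exists>Xb\<in>{X. 0 \<in> T_phi h F A C b Q X} \<inter> primal_solutions h F A C b Q.
          \<exists>(yb, wb, Sb)\<in>multipliers h F A C b Q Xb.
            rank (mat_of Sb) \<ge> CARD('n) - 1)
         \<or>
         (\<exists>Xb\<in>{X. 0 \<in> T_phi h F A C b Q X} \<inter> primal_solutions h F A C b Q.
          \<exists>(yb, wb, Sb)\<in>multipliers h F A C b Q Xb.
            rank (mat_of Xb) + rank (mat_of Sb) = CARD('n))"
  shows "\<forall>X\<in>{X. 0 \<in> T_phi h F A C b Q X}. metrically_subregular (T_phi h F A C b Q) X 0"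
proof -
  note lin = assms(1,2) and Q = assms(3) and fin = assms(5) and op = assms(7) and cvx = assms(8)
  have str: "strictly_convex_on (edom h) h" using assms(11) cvx by blast
  have der: "GDERIV (\<lambda>u. real_of_ereal (h u)) w :> grad_h w" if "w \<in> edom h" for w
    using assms(9) that by blast
  have gi: "h w + ereal (grad_h w \<bullet> (x - w)) \<le> h x" if "w \<in> edom h" for w x
    using gradient_inequality[OF fin cvx str that der[OF that]] .
  let ?T = "T_phi h F A C b Q" and ?phi = "phi h F A C b Q"
  obtain Xb y w S where zero: "0 \<in> ?T Xb" and sol: "Xb \<in> primal_solutions h F A C b Q"
    and mult: "(y, w, S) \<in> multipliers h F A C b Q Xb"
    and rk: "rank (mat_of S) \<ge> CARD('n) - 1 \<or> rank (mat_of Xb) + rank (mat_of S) = CARD('n)"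
    using assms(13) by blast
  note M = multipliersD[OF mult Q]
  define w0 where "w0 = F Xb"
  \<comment> \<open>Primal optimality enters here: a zero of \<open>T_phi\<close> alone might have
    \<open>F Xb\<close> on the boundary of \<open>edom h\<close>.\<close>
  have w0: "w0 \<in> edom h"
  proof -
    have "primal_objective h F C Xb < \<infinity>" using sol by (simp add: primal_solutions_def)
    then show ?thesis
      using M(5) by (cases "h (F Xb)") (auto simp: primal_objective_def edom_def w0_def indicator_fn_def)
  qed
  then obtain \<eta> where \<eta>: "h w0 = ereal \<eta>" using edom_real[OF fin] by blast
  have wg: "- w = grad_h w0"
    using conjugate_subgradient_eq_gradient[OF fin op w0 der[OF w0] gi[OF w0]] M(7) by (simp add: w0_def)

  \<comment> \<open>Optimal value and local growth\<close>
  define p where "p = - (\<eta> + w \<bullet> w0 + y \<bullet> b)"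
  let ?\<Omega> = "kkt_face F A b Q w0 y S"
  have Xb: "Xb \<in> ?\<Omega>"
    using M psd_inner_eq_0_iff by (auto simp: kkt_face_def w0_def)
  have CX: "C \<bullet> X = y \<bullet> A X + w \<bullet> F X + S \<bullet> X" for X
    using dual_feasible_inner[OF lin M(8)] .
  have phi_ge: "ereal p \<le> ?phi X" if X: "X \<in> ?\<Omega>" for X
  proof -
    have x: "X \<in> psd_cone" "b - A X \<in> polar_cone Q" "F X = w0" "y \<bullet> (A X - b) = 0" "S \<bullet> X = 0"
      using X psd_inner_eq_0_iff[OF M(4)] by (auto simp: kkt_face_def)
    then have "p = - (\<eta> + C \<bullet> X)" by (simp add: p_def CX inner_diff_right)
    then show ?thesis using phi_lower[OF lin x(1,2)] x(3) \<eta> by simp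
  qed
  obtain \<kappa> W0 where \<kappa>: "\<kappa> > 0" "open W0" "w0 \<in> W0"
    "\<And>w'. w' \<in> W0 \<Longrightarrow> h w0 + ereal (grad_h w0 \<bullet> (w' - w0) + \<kappa> * (norm (w' - w0))\<^sup>2) \<le> h w'"
    using assms(12) w0 by blast
  \<comment> \<open>The growth of \<open>h\<close> holds on \<open>W0\<close>, while
    \<open>phi_upper\<close> needs a gradient at \<open>F X\<close> and hence a point of the
    domain.\<close>
  define W where "W = W0 \<inter> edom h"
  have W: "open W" "w0 \<in> W" using \<kappa> op w0 by (auto simp: W_def)
  let ?gap = "\<lambda>X. \<kappa> * (norm (F X - w0))\<^sup>2 + y \<bullet> (A X - b) + S \<bullet> X"
  have growth: "?phi X \<le> ereal (p - ?gap X)" if "F X \<in> W" for X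
    unfolding p_def
    by (rule phi_local_growth[where g = "grad_h (F X)"])
       (use that lin Q fin gi \<eta> M(8) \<kappa>(4) wg in \<open>auto simp: W_def\<close>)
  have gap0: "?gap Xb = 0" using M(3,6) by (simp add: w0_def)
  have "F Xb \<in> W" using W(2) by (simp add: w0_def)
  from growth[OF this] phi_ge[OF Xb] have phib: "?phi Xb = ereal p" unfolding gap0 by simp
  have le: "?phi Y \<le> ereal p" for Y using zero phib by (simp add: zero_in_T_phi_iff)
  have feas: "X \<in> psd_cone \<and> b - A X \<in> polar_cone Q" if "\<bar>?phi X\<bar> \<noteq> \<infinity>" for X
    using phi_finite_imp_feasible[OF lin Q conjugate_eq[OF \<eta> gi[OF w0]] that] by blast
  have gap_parts: "0 \<le> y \<bullet> (A X - b)" "0 \<le> S \<bullet> X" if "\<bar>?phi X\<bar> \<noteq> \<infinity>" for X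
  proof -
    have "(b - A X) \<bullet> y \<le> 0" using feas[OF that] M(1) by (simp add: polar_cone_def)
    then show "0 \<le> y \<bullet> (A X - b)" by (simp add: inner_diff_left inner_diff_right inner_commute)
    show "0 \<le> S \<bullet> X" using feas[OF that] psd_inner_nonneg[OF M(4)] by blast
  qed

  \<comment> \<open>The zero set of \<open>T_phi\<close>\<close>
  have zeros: "0 \<in> ?T X \<longleftrightarrow> X \<in> ?\<Omega>" for X
  proof
    assume "X \<in> ?\<Omega>"
    then have "?phi X = ereal p" using phi_ge le by (intro antisym) auto
    then show "0 \<in> ?T X" using le by (simp add: zero_in_T_phi_iff)
  next
    assume X: "0 \<in> ?T X"
    then have px: "?phi X = ereal p" using le phib by (metis antisym zero_in_T_phi_iff)
    \<comment> \<open>\<open>F X\<close> may lie outside \<open>W\<close>, so a point near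
      \<open>Xb\<close> on the segment towards \<open>X\<close> is used. Concavity keeps the value
      \<open>p\<close> there, the gap vanishes, and its vanishing parts carry over to
      \<open>X\<close> because \<open>t > 0\<close>.\<close>
    define Y where "Y t = (1 - t) *\<^sub>R Xb + t *\<^sub>R X" for t
    have FY: "F (Y t) = w0 + t *\<^sub>R (F X - w0)" for t
      unfolding Y_def linear_add[OF lin(1)] linear_cmul[OF lin(1)] w0_def
      by (simp add: algebra_simps)
    have "((\<lambda>t. w0 + t *\<^sub>R (F X - w0)) \<longlongrightarrow> w0 + 0 *\<^sub>R (F X - w0)) (at_right 0)"
      by (intro tendsto_intros)
    then have "eventually (\<lambda>t. F (Y t) \<in> W) (at_right 0)"
      using W unfolding FY by (auto dest: topological_tendstoD)
    moreover have "eventually (\<lambda>t. t \<in> {0<..<1}) (at_right (0::real))"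
      by (rule eventually_at_right_real) simp
    ultimately have "eventually (\<lambda>t. F (Y t) \<in> W \<and> t \<in> {0<..<1}) (at_right 0)"
      by (rule eventually_conj)
    then obtain t where t: "F (Y t) \<in> W" "0 < t" "t < 1"
      using eventually_happens'[OF trivial_limit_at_right_real] by force
    have "ereal p \<le> ?phi (Y t)"
      unfolding Y_def using phib px t by (intro phi_superlevel_convex) auto
    then have pY: "?phi (Y t) = ereal p" using le by (intro antisym) auto
    then have "?gap (Y t) \<le> 0" using growth[OF t(1)] by simp
    moreover have "0 \<le> y \<bullet> (A (Y t) - b)" "0 \<le> S \<bullet> Y t" "0 \<le> \<kappa> * (norm (F (Y t) - w0))\<^sup>2"
      using gap_parts[of "Y t"] pY \<kappa>(1) by simp_all
    ultimately have "y \<bullet> (A (Y t) - b) = 0" "S \<bullet> Y t = 0" "\<kappa> * (norm (F (Y t) - w0))\<^sup>2 = 0"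
      by linarith+
    moreover have "y \<bullet> (A (Y t) - b) = t * (y \<bullet> (A X - b)) + (1 - t) * (y \<bullet> (A Xb - b))"
      unfolding Y_def linear_add[OF lin(2)] linear_cmul[OF lin(2)]
      by (simp add: inner_diff_right inner_add_right algebra_simps)
    moreover have "S \<bullet> Y t = t * (S \<bullet> X) + (1 - t) * (S \<bullet> Xb)"
      by (simp add: Y_def inner_add_right)
    ultimately have "y \<bullet> (A X - b) = 0" "S \<bullet> X = 0" "F X = w0"
      using t(2) \<kappa>(1) M(3,6) by (simp_all add: FY)
    then show "X \<in> ?\<Omega>"
      using feas[of X] px psd_inner_eq_0_iff[OF M(4)] by (simp add: kkt_face_def)
  qed

  \<comment> \<open>The error bound near an arbitrary zero\<close>
  show ?thesis
  proof
    fix Xh assume Xh: "Xh \<in> {X. 0 \<in> ?T X}"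
    then have FXh: "F Xh = w0" using zeros by (simp add: kkt_face_def)
    \<comment> \<open>Bounds the norm on the unit ball around \<open>Xh\<close>, to which
      \<open>U\<close> is confined.\<close>
    let ?R = "norm Xh + 1"
    have "Xb \<in> kkt_face F A b Q w0 y S" using Xb .
    from kkt_face_error_bound[OF lin Q assms(4) M(4,1) this rk, of ?R]
    obtain K where K: "K \<ge> 0" "\<And>X. X \<in> psd_cone \<Longrightarrow> b - A X \<in> polar_cone Q \<Longrightarrow> norm X \<le> ?R \<Longrightarrow>
      \<exists>P\<in>?\<Omega>. (norm (X - P))\<^sup>2 \<le> K * ((norm (F X - w0))\<^sup>2 + y \<bullet> (A X - b) + S \<bullet> X)"
      by blast
    \<comment> \<open>The factor \<open>1 + 1 / \<kappa>\<close> absorbs the weight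
      \<open>\<kappa>\<close> in the gap; \<open>K + 1\<close> makes \<open>L\<close> positive even
      if \<open>K = 0\<close>.\<close>
    define L where "L = (K + 1) * (1 + 1 / \<kappa>)"
    have L: "L > 0" using K(1) \<kappa>(1) by (simp add: L_def add_pos_pos)
    define U where "U = F -` W \<inter> ball Xh 1"
    have "open (F -` W)"
      using W(1) linear_continuous_on[OF linear_conv_bounded_linear[THEN iffD1, OF lin(1)], of UNIV]
      by (simp add: open_vimage)
    then have U: "open U" "Xh \<in> U" using W(2) FXh by (auto simp: U_def)
    show "metrically_subregular ?T Xh 0"
    proof (rule metrically_subregular_if_error_bound[OF _ U L])
      show "0 \<in> ?T Xh" using Xh by simp
      fix X V assume X: "X \<in> U" and V: "V \<in> ?T X"
      have phiX: "\<bar>?phi X\<bar> \<noteq> \<infinity>" using V by (simp add: T_phi_iff)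
      have nX: "norm X \<le> ?R"
        using X norm_triangle_ineq2[of X Xh] by (simp add: U_def dist_norm norm_minus_commute)
      obtain P where P: "P \<in> ?\<Omega>"
        "(norm (X - P))\<^sup>2 \<le> K * ((norm (F X - w0))\<^sup>2 + y \<bullet> (A X - b) + S \<bullet> X)"
        using K(2) feas[OF phiX] nX by blast
      have "(norm (F X - w0))\<^sup>2 + y \<bullet> (A X - b) + S \<bullet> X \<le> (1 + 1 / \<kappa>) * ?gap X"
        using gap_parts[OF phiX] \<kappa>(1) by (simp add: field_simps)
      then have "K * ((norm (F X - w0))\<^sup>2 + y \<bullet> (A X - b) + S \<bullet> X) \<le> K * ((1 + 1 / \<kappa>) * ?gap X)"
        using K(1) by (rule mult_left_mono)
      moreover have gap: "0 \<le> ?gap X" using gap_parts[OF phiX] \<kappa>(1) by simp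
      then have "K * ((1 + 1 / \<kappa>) * ?gap X) \<le> L * ?gap X"
        unfolding L_def mult.assoc using \<kappa>(1) by (intro mult_right_mono mult_nonneg_nonneg) auto
      ultimately have 1: "(norm (X - P))\<^sup>2 \<le> L * ?gap X" using P(2) by linarith
      obtain q where q: "?phi X = ereal q" using phiX by (cases "?phi X") auto
      have "?phi P = ereal p" using P(1) phi_ge le by (intro antisym) auto
      \<comment> \<open>The subgradient inequality at \<open>P\<close> bounds the gap by
        \<open>norm V * norm (X - P)\<close>. With the quadratic bound on
        \<open>norm (X - P)\<close>, one factor cancels.\<close>
      moreover have "- ?phi X + ereal (V \<bullet> (P - X)) \<le> - ?phi P" using V by (simp add: T_phi_iff)
      ultimately have "p - q \<le> V \<bullet> (X - P)" by (simp add: q inner_diff_right)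
      moreover have "q \<le> p - ?gap X" using growth[of X] X q by (simp add: U_def)
      moreover have "V \<bullet> (X - P) \<le> norm V * norm (X - P)" by (rule norm_cauchy_schwarz)
      ultimately have "?gap X \<le> norm V * norm (X - P)" by linarith
      then have "L * ?gap X \<le> L * (norm V * norm (X - P))" using L by simp
      with 1 have "norm (X - P) * norm (X - P) \<le> (L * norm V) * norm (X - P)"
        by (simp add: power2_eq_square mult.assoc)
      then have "norm (X - P) \<le> L * norm V"
        using L by (cases "norm (X - P) = 0") (auto simp: mult_le_cancel_right)
      then show "\<exists>P. 0 \<in> ?T P \<and> norm (X - P) \<le> L * norm V" using P(1) zeros by blast
    qed
  qed
qed

end
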